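(* Let Algorithm 1 be run on the convex program $\min f(x)$ s.t. $g(x)\le 0$ (algorithm, data and standing assumptions as in the context). For given tolerances $\overline\delta>0$ and $\overline\varepsilon>0$, after at most $$M:=2\left\lceil\max\left\{\frac{d_0^2}{\overline\delta\,\tau(1-\sigma)\eta},\ \frac{\sigma^{4/3}d_0^2}{\overline\varepsilon^{2/3}\tau(1-\sigma^2)(2\eta)^{2/3}}\right\}\right\rceil+\left\lceil\frac{\max\left\{\log^+\!\left((1+1/\sigma)\overline\rho/(\overline\delta\lambda_1)\right),\ \log^+\!\left(\overline\rho^2/(2\overline\varepsilon\lambda_1)\right)\right\}}{\log(1/(1-\tau))}\right\rceil$$ iterations, Algorithm 1 finds $((x,y),v,\varepsilon)$ such that $$v\in\partial_\varepsilon\left(\overline{\mathscr L}(\cdot,y)-\overline{\mathscr L}(x,\cdot)\right)(x,y),\qquad \|v\|\le\overline\delta,\qquad \varepsilon\le\overline\varepsilon,$$ with the property that $((x,y),(p,q),\varepsilon)$, where $(p,q):=v\in\mathbb R^n\times\mathbb R^m$, also satisfies $$p=\nabla f(x)+\nabla g(x)y,\quad g(x)+q\le 0,\quad y\ge 0,\quad \langle y,g(x)+q\rangle=-\varepsilon,\quad \|(p,q)\|\le\overline\delta,\quad \varepsilon\le\overline\varepsilon.$$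
   Context: Notation: $\langle\cdot,\cdot\rangle$, $\|\cdot\|$ are Euclidean; for vectors, $(\cdot)_+$, $(\cdot)_-$, $|\cdot|$ and inequalities are componentwise with $t_+=\max\{t,0\}$, $t_-=\max\{-t,0\}$; $\log^+ t=\max\{\log t,0\}$. Problem: $\min f(x)$ s.t. $g(x)\le 0$, with $f:\mathbb R^n\to\mathbb R$, $g=(g_1,\dots,g_m):\mathbb R^n\to\mathbb R^m$. Standing assumptions: (O.1) $f,g_1,\dots,g_m$ are convex and $C^2$; (O.2) the Hessians of $f,g_1,\dots,g_m$ are Lipschitz continuous with constants $L_0,L_1,\dots,L_m$, and $L_i\ne0$ for some $i\ge1$; (O.3) there is $(x,y)\in\mathbb R^n\times\mathbb R^m$ satisfying the KKT conditions $\nabla f(x)+\nabla g(x)y=0$, $g(x)\le0$, $y\ge0$, $\langle y,g(x)\rangle=0$. Here $\nabla g(x)$ is the $n\times m$ matrix with columns $\nabla g_i(x)$. $L_g:=(L_1,\dots,L_m)$. $\mathbf S(x,y):=(\nabla f(x)+\nabla g(x)y,\,-g(x))$. For $\mathring z\in\mathbb R^n\times\mathbb R^m$, $\lambda\in\mathbb R$, $z=(x,y)\in\mathbb R^n\times\mathbb R^m_+$: $\Psi_{\mathbf S,\mathring z,\lambda}(z):=\min_{w\in\mathbb R^m_+}\|\lambda(\mathbf S(z)-(0,w))+z-\mathring z\|^2+2\lambda\langle y,w\rangle$. For $\lambda>0$ and $\theta'\ge0$, $\mathcal N_{\theta'}(\mathring z,\lambda)$ is the set of $(x,y)\in\mathbb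 R^n\times\mathbb R^m_+$ with $\lambda\left(\frac{L_0+\langle L_g,|y|\rangle}{2}+\frac{2\|L_g\|}{3}\rho\right)\rho\le\theta'$, where $\rho=\sqrt{\Psi_{\mathbf S,\mathring z,\lambda}(x,y)}$. For $y\in\mathbb R^m$, $\alpha>0$, $\rho(y,\alpha)$ is the largest root $\rho$ of $\left(\frac{L_0+\langle L_g,|y|\rangle}{2}+\frac{2\|L_g\|}{3}\rho\right)\rho=\alpha$. For $\tilde x\in\mathbb R^n$, $f_{[\tilde x]}$ and $g_{[\tilde x]}=(g_{1,[\tilde x]},\dots,g_{m,[\tilde x]})$ are the second-order Taylor polynomials of $f$ and of the components of $g$ at $\tilde x$. Algorithm 1. Initialization: choose $(x_0,y_0)=(\tilde x_1,\tilde y_1)\in\mathbb R^n\times\mathbb R^m_+$, $0<\sigma<1$, $0<\theta\le1/4$; let $h$ be the positive root of $\theta(1+h')(1+h'(1+1/\sigma))^2=1$ (unknown $h'$) and $\tau=h/(1+h)$; choose $\lambda_1>0$ with $(\tilde x_1,\tilde y_1)\in\mathcal N_{\theta^2}((x_0,y_0),\lambda_1)$. It is assumed that $(\tilde x_1,\tilde y_1)$ does not satisfy the KKT conditions. Iteration $k=1,2,\dots$: write $z_{k-1}=(x_{k-1},y_{k-1})$, $\tilde z_k=(\tilde x_k,\tilde y_k)$, $\rho_k=\rho(\tilde y_k,\theta^2/\lambda_k)$. - If $\rho_k\le\sigma\|\tilde z_k-z_{k-1}\|$: $\lambda_{k+1}=(1-\tau)\lambda_k$, $\tilde z_{k+1}=\tilde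 z_k$, $x_k=x_{k-1}-\tau\lambda_k[\nabla f(\tilde x_k)+\nabla g(\tilde x_k)\tilde y_k]$, $y_k=y_{k-1}+\tau[\lambda_kg(\tilde x_k)+(\lambda_kg(\tilde x_k)+y_{k-1})_-]$. - Otherwise: $\lambda_{k+1}=(1-\tau)^{-1}\lambda_k$, $z_k=z_{k-1}$, and $\tilde z_{k+1}$ is the (unique) solution of $\min_{x\in\mathbb R^n}\max_{y\in\mathbb R^m_+} f_{[\tilde x_k]}(x)+\langle y,g_{[\tilde x_k]}(x)\rangle+\frac{\|x-x_k\|^2-\|y-y_k\|^2}{2\lambda_{k+1}}$. Associated quantities for $k\ge1$: $w_k=(g(\tilde x_k)+\lambda_k^{-1}y_{k-1})_-$, $v_k=\mathbf S(\tilde z_k)-(0,w_k)$, $\varepsilon_k=\langle\tilde y_k,w_k\rangle$. "After at most $M$ iterations Algorithm 1 finds $((x,y),v,\varepsilon)$" means that $((x,y),v,\varepsilon)=(\tilde z_k,v_k,\varepsilon_k)$ for some $1\le k\le M$. $\mathcal K$ is the set of pairs satisfying the KKT conditions and $d_0$ is the distance from $z_0=(x_0,y_0)$ to $\mathcal K$. Constants: $c:=\frac{L_0+\langle L_g,|y_0|\rangle}{2}+\left[\frac12+\frac{1/2+2\sigma/3}{\sqrt{1-\sigma^2}}\right]d_0\|L_g\|$, $\ \eta:=\frac{\theta^2}{\sigma c}$, $\ \overline\rho:=\dfrac{2\theta^2}{\lambda_1\left(\frac{L_0}{2}+\sqrt{\left(\frac{L_0}{2}\right)^2+\frac{8\|L_g\|\theta^2}{3\lambda_1}}\right)}$.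 $\overline{\mathscr L}(x,y):=f(x)+\langle y,g(x)\rangle$ if $y\ge0$, and $-\infty$ otherwise. For $y\ge0$, $\overline{\mathscr L}(\cdot,y)-\overline{\mathscr L}(x,\cdot)$ is the function $(x',y')\mapsto\overline{\mathscr L}(x',y)-\overline{\mathscr L}(x,y')$ on $\mathbb R^n\times\mathbb R^m$, and $\partial_\varepsilon$ ($\varepsilon\ge0$) is the usual $\varepsilon$-subdifferential of convex analysis. *)

theory Defs
  imports "HOL-Analysis.Analysis"
begin

(* On real^'m the library order and abs are componentwise (less_eq_vec_def, abs_vec_def), so
   {0..} is the nonnegative orthant.  On a product type the library norm is Euclidean. *)

definition neg_part :: "real^'m \<Rightarrow> real^'m" where
  "neg_part v = (\<chi> i. max (- (v $ i)) 0)"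

definition log_plus :: "real \<Rightarrow> real" where
  "log_plus t = max (ln t) 0"


definition gradient :: "('a::real_inner \<Rightarrow> real) \<Rightarrow> 'a \<Rightarrow> 'a" where
  "gradient f x = (THE D. GDERIV f x :> D)"

(* The n x m matrix whose columns are the gradients of the components of g. *)
definition gradient_matrix :: "(real^'n \<Rightarrow> real^'m) \<Rightarrow> real^'n \<Rightarrow> real^'m^'n" where
  "gradient_matrix g x = (\<chi> j i. gradient (\<lambda>u. g u $ i) x $ j)"

(* As a bounded linear operator, so that norms of (differences of) Hessians are operator norms. *)
definition hessian :: "(real^'n \<Rightarrow> real) \<Rightarrow> real^'n \<Rightarrow> (real^'n) \<Rightarrow>\<^sub>L (real^'n)" where
  "hessian f x = Blinfun (frechet_derivative (gradient f) (at x))"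

definition C2 :: "(real^'n \<Rightarrow> real) \<Rightarrow> bool" where
  "C2 f \<longleftrightarrow> (\<forall>x. f differentiable (at x)) \<and> (\<forall>x. gradient f differentiable (at x)) \<and>
     continuous_on UNIV (hessian f)"

definition taylor2 :: "(real^'n \<Rightarrow> real) \<Rightarrow> real^'n \<Rightarrow> real^'n \<Rightarrow> real" where
  "taylor2 f xt x = f xt + inner (gradient f xt) (x - xt)
     + 1/2 * inner (x - xt) (blinfun_apply (hessian f xt) (x - xt))"

definition taylor2_vec :: "(real^'n \<Rightarrow> real^'m) \<Rightarrow> real^'n \<Rightarrow> real^'n \<Rightarrow> real^'m" where
  "taylor2_vec g xt x = (\<chi> i. taylor2 (\<lambda>u. g u $ i) xt x)"


definition KKT :: "(real^'n \<Rightarrow> real) \<Rightarrow> (real^'n \<Rightarrow> real^'m) \<Rightarrow> ((real^'n) \<times> (real^'m)) set" where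
  "KKT f g = {(x, y). gradient f x + gradient_matrix g x *v y = 0 \<and> g x \<le> 0 \<and> 0 \<le> y \<and>
     inner y (g x) = 0}"

definition standing_assumptions ::
  "(real^'n \<Rightarrow> real) \<Rightarrow> (real^'n \<Rightarrow> real^'m) \<Rightarrow> real \<Rightarrow> real^'m \<Rightarrow> bool" where
  "standing_assumptions f g L0 Lg \<longleftrightarrow>
     convex_on UNIV f \<and> C2 f \<and>
     (\<forall>i. convex_on UNIV (\<lambda>x. g x $ i) \<and> C2 (\<lambda>x. g x $ i)) \<and>
     lipschitz_on L0 UNIV (hessian f) \<and>
     (\<forall>i. lipschitz_on (Lg $ i) UNIV (hessian (\<lambda>x. g x $ i))) \<and>
     (\<exists>i. Lg $ i \<noteq> 0) \<and>
     KKT f g \<noteq> {}"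

definition saddle_op ::
  "(real^'n \<Rightarrow> real) \<Rightarrow> (real^'n \<Rightarrow> real^'m) \<Rightarrow> (real^'n) \<times> (real^'m) \<Rightarrow> (real^'n) \<times> (real^'m)" where
  "saddle_op f g z =
     (gradient f (fst z) + gradient_matrix g (fst z) *v snd z, - g (fst z))"

(* The infimum is a minimum for y >= 0. *)
definition Psi ::
  "((real^'n) \<times> (real^'m) \<Rightarrow> (real^'n) \<times> (real^'m)) \<Rightarrow> (real^'n) \<times> (real^'m) \<Rightarrow> real \<Rightarrow>
     (real^'n) \<times> (real^'m) \<Rightarrow> real" where
  "Psi S z0 lam z = (INF w\<in>{0..}.
     (norm (lam *\<^sub>R (S z - (0, w)) + z - z0))\<^sup>2 + 2 * lam * inner (snd z) w)"

definition nbhd ::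
  "(real^'n \<Rightarrow> real) \<Rightarrow> (real^'n \<Rightarrow> real^'m) \<Rightarrow> real \<Rightarrow> real^'m \<Rightarrow> real \<Rightarrow>
     (real^'n) \<times> (real^'m) \<Rightarrow> real \<Rightarrow> ((real^'n) \<times> (real^'m)) set" where
  "nbhd f g L0 Lg t z0 lam = {z. 0 \<le> snd z \<and>
     (let r = sqrt (Psi (saddle_op f g) z0 lam z)
      in lam * (((L0 + inner Lg \<bar>snd z\<bar>) / 2 + 2 * norm Lg / 3 * r) * r) \<le> t)}"

definition rho :: "real \<Rightarrow> real^'m \<Rightarrow> real^'m \<Rightarrow> real \<Rightarrow> real" where
  "rho L0 Lg y a =
     (GREATEST r. ((L0 + inner Lg \<bar>y\<bar>) / 2 + 2 * norm Lg / 3 * r) * r = a)"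

definition subproblem_obj ::
  "(real^'n \<Rightarrow> real) \<Rightarrow> (real^'n \<Rightarrow> real^'m) \<Rightarrow> real^'n \<Rightarrow> (real^'n) \<times> (real^'m) \<Rightarrow> real \<Rightarrow>
     real^'n \<Rightarrow> real^'m \<Rightarrow> real" where
  "subproblem_obj f g xt zk lam x y =
     taylor2 f xt x + inner y (taylor2_vec g xt x)
     + ((norm (x - fst zk))\<^sup>2 - (norm (y - snd zk))\<^sup>2) / (2 * lam)"

(* (x, y) solves  min over x of max over y >= 0 of F x y.  In the intended use F x is strongly
   concave for every x, so the supremum is finite and attained. *)
definition solves_min_max :: "('a \<Rightarrow> real^'m \<Rightarrow> real) \<Rightarrow> 'a \<times> (real^'m) \<Rightarrow> bool" where
  "solves_min_max F z \<longleftrightarrow>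
     is_arg_min (\<lambda>x. SUP y\<in>{0..}. F x y) (\<lambda>_. True) (fst z) \<and>
     is_arg_max (F (fst z)) (\<lambda>y. 0 \<le> y) (snd z)"


(* z, zt, lam are the sequences z_k (k >= 0), tilde z_k (k >= 1) and lambda_k (k >= 1);
   zt 0 and lam 0 are irrelevant. *)
definition algorithm1_init ::
  "(real^'n \<Rightarrow> real) \<Rightarrow> (real^'n \<Rightarrow> real^'m) \<Rightarrow> real \<Rightarrow> real^'m \<Rightarrow> real \<Rightarrow> real \<Rightarrow> real \<Rightarrow>
     (nat \<Rightarrow> (real^'n) \<times> (real^'m)) \<Rightarrow> (nat \<Rightarrow> (real^'n) \<times> (real^'m)) \<Rightarrow> (nat \<Rightarrow> real) \<Rightarrow> bool" where
  "algorithm1_init f g L0 Lg \<sigma> \<theta> \<tau> z zt lam \<longleftrightarrow>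
     z 0 = zt 1 \<and> 0 \<le> snd (zt 1) \<and>
     0 < \<sigma> \<and> \<sigma> < 1 \<and> 0 < \<theta> \<and> \<theta> \<le> 1/4 \<and>
     (\<exists>h>0. \<theta> * (1 + h) * (1 + h * (1 + 1/\<sigma>))\<^sup>2 = 1 \<and> \<tau> = h / (1 + h)) \<and>
     lam 1 > 0 \<and> zt 1 \<in> nbhd f g L0 Lg (\<theta>\<^sup>2) (z 0) (lam 1) \<and>
     zt 1 \<notin> KKT f g"

definition algorithm1_step ::
  "(real^'n \<Rightarrow> real) \<Rightarrow> (real^'n \<Rightarrow> real^'m) \<Rightarrow> real \<Rightarrow> real^'m \<Rightarrow> real \<Rightarrow> real \<Rightarrow> real \<Rightarrow>
     (nat \<Rightarrow> (real^'n) \<times> (real^'m)) \<Rightarrow> (nat \<Rightarrow> (real^'n) \<times> (real^'m)) \<Rightarrow> (nat \<Rightarrow> real) \<Rightarrow> nat \<Rightarrow> bool" where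
  "algorithm1_step f g L0 Lg \<sigma> \<theta> \<tau> z zt lam k \<longleftrightarrow>
     (let xt = fst (zt k); yt = snd (zt k); x = fst (z (k - 1)); y = snd (z (k - 1)) in
      if rho L0 Lg yt (\<theta>\<^sup>2 / lam k) \<le> \<sigma> * norm (zt k - z (k - 1)) then
        lam (k + 1) = (1 - \<tau>) * lam k \<and>
        zt (k + 1) = zt k \<and>
        z k = (x - (\<tau> * lam k) *\<^sub>R (gradient f xt + gradient_matrix g xt *v yt),
               y + \<tau> *\<^sub>R (lam k *\<^sub>R g xt + neg_part (lam k *\<^sub>R g xt + y)))
      else
        lam (k + 1) = inverse (1 - \<tau>) * lam k \<and>
        z k = z (k - 1) \<and>
        solves_min_max (subproblem_obj f g xt (z k) (lam (k + 1))) (zt (k + 1)))"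

definition algorithm1 ::
  "(real^'n \<Rightarrow> real) \<Rightarrow> (real^'n \<Rightarrow> real^'m) \<Rightarrow> real \<Rightarrow> real^'m \<Rightarrow> real \<Rightarrow> real \<Rightarrow> real \<Rightarrow>
     (nat \<Rightarrow> (real^'n) \<times> (real^'m)) \<Rightarrow> (nat \<Rightarrow> (real^'n) \<times> (real^'m)) \<Rightarrow> (nat \<Rightarrow> real) \<Rightarrow> bool" where
  "algorithm1 f g L0 Lg \<sigma> \<theta> \<tau> z zt lam \<longleftrightarrow>
     algorithm1_init f g L0 Lg \<sigma> \<theta> \<tau> z zt lam \<and>
     (\<forall>k\<ge>1. algorithm1_step f g L0 Lg \<sigma> \<theta> \<tau> z zt lam k)"

definition w_seq ::
  "(real^'n \<Rightarrow> real^'m) \<Rightarrow> (nat \<Rightarrow> (real^'n) \<times> (real^'m)) \<Rightarrow> (nat \<Rightarrow> (real^'n) \<times> (real^'m)) \<Rightarrow>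
     (nat \<Rightarrow> real) \<Rightarrow> nat \<Rightarrow> real^'m" where
  "w_seq g z zt lam k = neg_part (g (fst (zt k)) + inverse (lam k) *\<^sub>R snd (z (k - 1)))"

definition v_seq ::
  "(real^'n \<Rightarrow> real) \<Rightarrow> (real^'n \<Rightarrow> real^'m) \<Rightarrow> (nat \<Rightarrow> (real^'n) \<times> (real^'m)) \<Rightarrow>
     (nat \<Rightarrow> (real^'n) \<times> (real^'m)) \<Rightarrow> (nat \<Rightarrow> real) \<Rightarrow> nat \<Rightarrow> (real^'n) \<times> (real^'m)" where
  "v_seq f g z zt lam k = saddle_op f g (zt k) - (0, w_seq g z zt lam k)"

definition eps_seq ::
  "(real^'n \<Rightarrow> real^'m) \<Rightarrow> (nat \<Rightarrow> (real^'n) \<times> (real^'m)) \<Rightarrow> (nat \<Rightarrow> (real^'n) \<times> (real^'m)) \<Rightarrow>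
     (nat \<Rightarrow> real) \<Rightarrow> nat \<Rightarrow> real" where
  "eps_seq g z zt lam k = inner (snd (zt k)) (w_seq g z zt lam k)"


definition Lbar ::
  "(real^'n \<Rightarrow> real) \<Rightarrow> (real^'n \<Rightarrow> real^'m) \<Rightarrow> real^'n \<Rightarrow> real^'m \<Rightarrow> ereal" where
  "Lbar f g x y = (if 0 \<le> y then ereal (f x + inner y (g x)) else -\<infinity>)"

(* Empty at points where F is not finite. *)
definition eps_subdiff :: "real \<Rightarrow> ('a::real_inner \<Rightarrow> ereal) \<Rightarrow> 'a \<Rightarrow> 'a set" where
  "eps_subdiff e F u = {v. \<bar>F u\<bar> \<noteq> \<infinity> \<and>
     (\<forall>u'. F u' \<ge> F u + ereal (inner v (u' - u)) - ereal e)}"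

end

theory Submission
  imports Defs
begin

text \<open>
  Every iterate satisfies a relative error condition: the residual
  \<open>\<parallel>\<lambda>\<^sub>k v\<^sub>k + zt\<^sub>k - z\<^sub>k\<^sub>-\<^sub>1\<parallel>\<^sup>2 + 2 \<lambda>\<^sub>k \<epsilon>\<^sub>k\<close> is at most \<open>\<rho>\<^sub>k\<^sup>2\<close>. This is kept invariant because an
  extragradient step does not increase the residual, while after increasing \<open>\<lambda>\<close> the point lies in
  the neighbourhood of size \<open>\<theta>\<close>, from which one proximal-Newton step contracts quadratically to
  size \<open>\<theta>\<^sup>2\<close>. If many extragradient steps occur, Fejer monotonicity makes the squared step lengths
  summable, and since \<open>\<lambda>\<^sub>k\<close> times the step length is at least \<open>\<eta>\<close>, one of the steps has a small
  residual. Otherwise \<open>\<lambda>\<close> has been increased so much more often than decreased that the residual,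
  which is \<open>O(1/\<lambda>\<^sub>k)\<close>, is small at the last increase.
\<close>

section \<open>Functions with Lipschitz continuous Hessian\<close>

text \<open>The Lipschitz constant of the Hessian of the Lagrangian depends on the multiplier, hence
  neighbourhoods whose size involves \<open>y\<close>; the term with \<open>2 * norm Lg / 3\<close>
  pays for the change of \<open>y\<close> in a Newton step. The equation for \<open>h\<close> is the
  budget of one increase of \<open>lam\<close> by \<open>1 + h = 1 / (1 - \<tau>)\<close>: the
  residual bound grows by at most \<open>q = 1 + h * (1 + 1/\<sigma>)\<close>, the quantity defining
  the neighbourhood by at most \<open>(1 + h) * q\<^sup>2 = 1 / \<theta>\<close>, so size
  \<open>\<theta>\<^sup>2\<close> becomes size \<open>\<theta>\<close>. The constant
  \<open>c\<close> bounds the multiplier dependence on all large steps by \<open>d0\<close> and the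
  starting multiplier, which gives \<open>\<eta>\<close>. A large step of length \<open>D\<close>
  then has \<open>norm v\<close> of order \<open>D\<^sup>2\<close> and \<open>eps\<close> of order
  \<open>D ^ 3\<close>, while among \<open>N\<close> of them one has \<open>D\<^sup>2\<close> of
  order \<open>1 / N\<close>; this is the origin of the exponents \<open>2/3\<close>. The factor 2
  in the count \<open>2 * N + n\<close> makes fewer than \<open>N\<close> large steps mean that the
  small ones outnumber them by more than \<open>n\<close>.\<close>

lemma GDERIV_gradient:
  fixes f :: "'a::euclidean_space \<Rightarrow> real"
  assumes "f differentiable (at x)"
  shows "GDERIV f x :> gradient f x"
proof -
  obtain f' where f': "(f has_derivative f') (at x)"
    using assms by (auto simp: differentiable_def)
  interpret bounded_linear f' using f' by (rule has_derivative_bounded_linear)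
  define D where "D = (\<Sum>b\<in>Basis. f' b *\<^sub>R b)"
  have "f' = (\<lambda>h. inner h D)"
  proof
    fix h
    have "f' h = f' (\<Sum>b\<in>Basis. (h \<bullet> b) *\<^sub>R b)" by (simp add: euclidean_representation)
    also have "\<dots> = inner h D"
      by (simp add: sum scaleR D_def inner_sum_right mult.commute)
    finally show "f' h = inner h D" .
  qed
  with f' have D: "GDERIV f x :> D" by (simp add: gderiv_def)
  \<comment> \<open>\<open>gradient\<close> is a definite description, so uniqueness is needed as
    well; it follows by comparing both representations on the vector \<open>E - D\<close>.\<close>
  moreover have "E = D" if "GDERIV f x :> E" for E
  proof -
    have "(\<lambda>h. inner h E) = (\<lambda>h. inner h D)"
      using that D unfolding gderiv_def by (rule has_derivative_unique)
    then have "inner (E - D) E = inner (E - D) D" by meson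
    then have "inner (E - D) (E - D) = 0" by (simp add: inner_diff_right)
    then show "E = D" by simp
  qed
  ultimately show ?thesis unfolding gradient_def by (rule theI)
qed

text \<open>Divide by \<open>s\<close> and let \<open>s\<close> tend to 0. All variational arguments
  below (Hessian positivity and symmetry, optimality in \<open>x\<close> and in \<open>y\<close>)
  end in this form, so no further limits are taken.\<close>

lemma first_order_coeff_nonneg:
  fixes a C :: real
  assumes "\<And>s. 0 < s \<Longrightarrow> s \<le> 1 \<Longrightarrow> 0 \<le> s * a + C * s\<^sup>2"
  shows "0 \<le> a"
proof (rule field_le_epsilon)
  fix e :: real assume "0 < e"
  define s where "s = min 1 (e / (\<bar>C\<bar> + 1))"
  have s: "0 < s" "s \<le> 1" using \<open>0 < e\<close> by (auto simp: s_def)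
  have "s * (\<bar>C\<bar> + 1) \<le> e / (\<bar>C\<bar> + 1) * (\<bar>C\<bar> + 1)"
    by (intro mult_right_mono) (auto simp: s_def)
  then have "s * (\<bar>C\<bar> + 1) \<le> e" by (simp add: add_nonneg_eq_0_iff)
  moreover have "C * s \<le> s * (\<bar>C\<bar> + 1)" using s by (simp add: mult.commute)
  moreover have "0 \<le> s * (a + C * s)"
    using assms[OF s] by (simp add: algebra_simps power2_eq_square)
  then have "0 \<le> a + C * s" using s by (simp add: zero_le_mult_iff)
  ultimately show "0 \<le> a + e" by linarith
qed

locale lipschitz_hessian =
  fixes f :: "real^'n \<Rightarrow> real" and L :: real
  assumes C2: "C2 f" and lipschitz: "lipschitz_on L UNIV (hessian f)"
begin

lemma L_nonneg: "0 \<le> L"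
  using lipschitz by (rule lipschitz_on_nonneg)

lemma has_derivative_f: "(f has_derivative (\<lambda>h. inner h (gradient f x))) (at x)"
  using GDERIV_gradient C2 unfolding C2_def gderiv_def by blast

lemma has_derivative_gradient: "(gradient f has_derivative blinfun_apply (hessian f x)) (at x)"
proof -
  have "(gradient f has_derivative frechet_derivative (gradient f) (at x)) (at x)"
    using C2 by (simp add: C2_def frechet_derivative_works)
  then show ?thesis
    unfolding hessian_def
    by (simp add: bounded_linear_Blinfun_apply has_derivative_bounded_linear)
qed

lemma hessian_diff_bound:
  "norm (hessian f x u - hessian f x' u) \<le> L * norm (x - x') * norm u"
proof -
  have "norm (hessian f x u - hessian f x' u) \<le> norm (hessian f x - hessian f x') * norm u"
    using norm_blinfun[of "hessian f x - hessian f x'" u] by (simp add: blinfun.diff_left)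
  also have "\<dots> \<le> L * norm (x - x') * norm u"
    using lipschitz_onD[OF lipschitz, of x x'] by (intro mult_right_mono) (auto simp: dist_norm)
  finally show ?thesis .
qed

lemma DERIV_f_line:
  "((\<lambda>t. f (x + t *\<^sub>R d)) has_real_derivative inner d (gradient f (x + t *\<^sub>R d))) (at t)"
proof -
  have "((\<lambda>t. f (x + t *\<^sub>R d)) has_derivative
      (\<lambda>h. inner (h *\<^sub>R d) (gradient f (x + t *\<^sub>R d)))) (at t)"
    by (rule has_derivative_compose[OF _ has_derivative_f]) (auto intro!: derivative_eq_intros)
  then show ?thesis
    by (simp add: has_field_derivative_def mult_commute_abs)
qed

lemma DERIV_gradient_line:
  "((\<lambda>t. inner u (gradient f (x + t *\<^sub>R d))) has_real_derivative
     inner u (hessian f (x + t *\<^sub>R d) d)) (at t)"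
proof -
  have "((\<lambda>t. gradient f (x + t *\<^sub>R d)) has_derivative
      (\<lambda>h. hessian f (x + t *\<^sub>R d) (h *\<^sub>R d))) (at t)"
    by (rule has_derivative_compose[OF _ has_derivative_gradient])
      (auto intro!: derivative_eq_intros)
  from has_derivative_inner_right[OF this, of u] show ?thesis
    by (simp add: has_field_derivative_def mult_commute_abs blinfun.scaleR_right)
qed

text \<open>Testing against a fixed \<open>u\<close> makes the remainder a real function of
  \<open>t\<close>, so a sign of one derivative suffices: Cauchy-Schwarz and the Lipschitz bound
  make the bound grow faster than the remainder. The parameter \<open>t\<close> stays free because
  \<open>taylor2_bound\<close> integrates once more.\<close>

lemma gradient_taylor_aux:
  assumes "0 \<le> t"
  shows "inner u (gradient f (x + t *\<^sub>R d) - gradient f x - t *\<^sub>R hessian f x d)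
    \<le> L / 2 * t\<^sup>2 * (norm d)\<^sup>2 * norm u"
proof -
  define \<phi> where "\<phi> s = L / 2 * s\<^sup>2 * (norm d)\<^sup>2 * norm u
    - (inner u (gradient f (x + s *\<^sub>R d)) - inner u (gradient f x) - s * inner u (hessian f x d))" for s
  have "\<phi> 0 \<le> \<phi> t"
  proof (rule DERIV_nonneg_imp_nondecreasing[OF assms])
    fix s assume "0 \<le> s" "s \<le> t"
    have "(\<phi> has_real_derivative L * s * (norm d)\<^sup>2 * norm u
      - inner u (hessian f (x + s *\<^sub>R d) d - hessian f x d)) (at s)"
      unfolding \<phi>_def
      by (auto intro!: derivative_eq_intros DERIV_gradient_line simp: inner_diff_right)
    moreover have "inner u (hessian f (x + s *\<^sub>R d) d - hessian f x d)
        \<le> norm u * norm (hessian f (x + s *\<^sub>R d) d - hessian f x d)"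
      by (rule norm_cauchy_schwarz)
    moreover have "\<dots> \<le> norm u * (L * norm (s *\<^sub>R d) * norm d)"
      using hessian_diff_bound[of "x + s *\<^sub>R d" d x] by (intro mult_left_mono) auto
    moreover have "\<dots> = L * s * (norm d)\<^sup>2 * norm u"
      using \<open>0 \<le> s\<close> by (simp add: power2_eq_square)
    ultimately show "\<exists>y. (\<phi> has_real_derivative y) (at s) \<and> 0 \<le> y"
      by (intro exI conjI) (assumption, linarith)
  qed
  then show ?thesis by (simp add: \<phi>_def inner_diff_right)
qed

lemma gradient_taylor:
  "norm (gradient f x' - gradient f x - hessian f x (x' - x)) \<le> L / 2 * (norm (x' - x))\<^sup>2"
proof -
  define u where "u = gradient f x' - gradient f x - hessian f x (x' - x)"
  \<comment> \<open>Here the test vector is the remainder itself, so one factor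
    \<open>norm u\<close> cancels.\<close>
  have "norm u * norm u \<le> L / 2 * (norm (x' - x))\<^sup>2 * norm u"
    using gradient_taylor_aux[of 1 u x "x' - x"]
    by (simp add: u_def power2_norm_eq_inner flip: power2_eq_square)
  then show ?thesis
    unfolding u_def[symmetric] using L_nonneg by (cases "u = 0") auto
qed

text \<open>Along the segment, the derivative of the Taylor remainder \<open>\<psi>\<close> is the
  gradient remainder, bounded by \<open>L / 2 * s\<^sup>2 * norm d ^ 3\<close>. Integrating yields
  \<open>L / 6\<close>; the two monotone functions \<open>\<dots> - \<psi>\<close> and
  \<open>\<dots> + \<psi>\<close> give the two signs.\<close>

lemma taylor2_bound: "\<bar>f x' - taylor2 f x x'\<bar> \<le> L / 6 * (norm (x' - x)) ^ 3"
proof -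
  define d where "d = x' - x"
  define \<psi> where "\<psi> s = f (x + s *\<^sub>R d) - f x - s * inner d (gradient f x)
    - s\<^sup>2 / 2 * inner d (hessian f x d)" for s
  have \<psi>': "(\<psi> has_real_derivative inner d (gradient f (x + s *\<^sub>R d) - gradient f x
    - s *\<^sub>R hessian f x d)) (at s)" for s
    unfolding \<psi>_def
    by (auto intro!: derivative_eq_intros DERIV_f_line simp: inner_diff_right)
  have bound: "L / 2 * s\<^sup>2 * (norm d)\<^sup>2 * norm d = L / 2 * s\<^sup>2 * norm d ^ 3" for s
    by (simp add: power2_eq_square power3_eq_cube)
  have "L / 6 * 0 ^ 3 * norm d ^ 3 - \<psi> 0 \<le> L / 6 * 1 ^ 3 * norm d ^ 3 - \<psi> 1"
  proof (rule DERIV_nonneg_imp_nondecreasing[where f = "\<lambda>s. L / 6 * s ^ 3 * norm d ^ 3 - \<psi> s"])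
    fix s :: real assume "0 \<le> s"
    have "((\<lambda>s. L / 6 * s ^ 3 * norm d ^ 3 - \<psi> s) has_real_derivative
      L / 2 * s\<^sup>2 * norm d ^ 3 - inner d (gradient f (x + s *\<^sub>R d) - gradient f x
        - s *\<^sub>R hessian f x d)) (at s)"
      by (rule derivative_eq_intros \<psi>' refl)+ simp
    then show "\<exists>y. ((\<lambda>s. L / 6 * s ^ 3 * norm d ^ 3 - \<psi> s) has_real_derivative y) (at s) \<and> 0 \<le> y"
      using gradient_taylor_aux[OF \<open>0 \<le> s\<close>, of d x d, unfolded bound]
      by (intro exI conjI) (assumption, simp)
  qed simp
  moreover have "L / 6 * 0 ^ 3 * norm d ^ 3 + \<psi> 0 \<le> L / 6 * 1 ^ 3 * norm d ^ 3 + \<psi> 1"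
  proof (rule DERIV_nonneg_imp_nondecreasing[where f = "\<lambda>s. L / 6 * s ^ 3 * norm d ^ 3 + \<psi> s"])
    fix s :: real assume "0 \<le> s"
    have "((\<lambda>s. L / 6 * s ^ 3 * norm d ^ 3 + \<psi> s) has_real_derivative
      L / 2 * s\<^sup>2 * norm d ^ 3 + inner d (gradient f (x + s *\<^sub>R d) - gradient f x
        - s *\<^sub>R hessian f x d)) (at s)"
      by (rule derivative_eq_intros \<psi>' refl)+ simp
    then show "\<exists>y. ((\<lambda>s. L / 6 * s ^ 3 * norm d ^ 3 + \<psi> s) has_real_derivative y) (at s) \<and> 0 \<le> y"
      using gradient_taylor_aux[OF \<open>0 \<le> s\<close>, of "- d" x d, unfolded norm_minus_cancel bound]
      by (intro exI conjI) (assumption, simp)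
  qed simp
  moreover have "\<psi> 0 = 0" by (simp add: \<psi>_def)
  moreover have "\<psi> 1 = f x' - taylor2 f x x'"
    by (simp add: \<psi>_def d_def taylor2_def inner_commute)
  ultimately show ?thesis
    unfolding abs_le_iff d_def by simp_all
qed

section \<open>Convexity, symmetry of the Hessian, and re-expansion of the Taylor polynomial\<close>

lemma taylor2_line:
  "taylor2 f x (x + s *\<^sub>R d)
    = f x + s * inner d (gradient f x) + s\<^sup>2 / 2 * inner d (hessian f x d)"
  by (simp add: taylor2_def blinfun.scaleR_right inner_commute power2_eq_square)

lemma above_tangent:
  assumes "convex_on UNIV f"
  shows "inner d (gradient f x) \<le> f (x + d) - f x"
proof -
  have conv: "convex_on UNIV (\<lambda>t. f (x + t *\<^sub>R d))"
  proof (rule convex_onI)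
    fix t a b :: real assume "0 < t" "t < 1"
    have "x + ((1 - t) *\<^sub>R a + t *\<^sub>R b) *\<^sub>R d = (1 - t) *\<^sub>R (x + a *\<^sub>R d) + t *\<^sub>R (x + b *\<^sub>R d)"
      by (simp add: algebra_simps)
    then show "f (x + ((1 - t) *\<^sub>R a + t *\<^sub>R b) *\<^sub>R d)
        \<le> (1 - t) * f (x + a *\<^sub>R d) + t * f (x + b *\<^sub>R d)"
      using convex_onD[OF assms, of t "x + a *\<^sub>R d" "x + b *\<^sub>R d"] \<open>0 < t\<close> \<open>t < 1\<close> by simp
  qed simp
  have "inner d (gradient f x) * (1 - 0) \<le> f (x + 1 *\<^sub>R d) - f (x + 0 *\<^sub>R d)"
    by (rule convex_on_imp_above_tangent[OF conv]) (use DERIV_f_line[of x d 0] in auto)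
  then show ?thesis by simp
qed

text \<open>The tangent inequality removes the terms of order 0 and 1 of the Taylor polynomial,
  leaving a quadratic term that must outweigh a cubic error for every small
  \<open>s\<close>.\<close>

lemma hessian_psd:
  assumes "convex_on UNIV f"
  shows "0 \<le> inner d (hessian f x d)"
proof -
  have "0 \<le> inner d (hessian f x d) / 2"
  proof (rule first_order_coeff_nonneg)
    fix s :: real assume s: "0 < s" "s \<le> 1"
    have "s * inner d (gradient f x) \<le> f (x + s *\<^sub>R d) - f x"
      using above_tangent[OF assms, of "s *\<^sub>R d" x] by simp
    moreover have "\<bar>f (x + s *\<^sub>R d) - taylor2 f x (x + s *\<^sub>R d)\<bar> \<le> L / 6 * norm (s *\<^sub>R d) ^ 3"
      using taylor2_bound[of "x + s *\<^sub>R d" x] by simp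
    ultimately have "0 \<le> s\<^sup>2 / 2 * inner d (hessian f x d) + L / 6 * norm (s *\<^sub>R d) ^ 3"
      unfolding taylor2_line abs_le_iff by linarith
    also have "\<dots> = s * (s * (inner d (hessian f x d) / 2) + L / 6 * norm d ^ 3 * s\<^sup>2)"
      using s by (simp add: power2_eq_square power3_eq_cube algebra_simps)
    finally show "0 \<le> s * (inner d (hessian f x d) / 2) + L / 6 * norm d ^ 3 * s\<^sup>2"
      using s by (simp add: zero_le_mult_iff)
  qed
  then show ?thesis by simp
qed

text \<open>Expanding \<open>f (x + s u + s v)\<close> to second order once at \<open>x\<close> and once at \<open>x + s u\<close>
  and letting \<open>s\<close> tend to \<open>0\<close> compares the two mixed terms.\<close>
lemma hessian_symmetric: "inner u (hessian f x v) = inner v (hessian f x u)"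
proof -
  have le: "inner v (hessian f x u) \<le> inner u (hessian f x v)" for u v
  proof -
    \<comment> \<open>\<open>C\<close> is twice the sum of five constants of order
      \<open>s ^ 3\<close>: three Taylor remainders of \<open>f\<close>, the error of the linearized
      gradient, and the error of replacing the Hessian at \<open>x'\<close> by that at
      \<open>x\<close>. The factor 2 comes from pulling out \<open>s / 2\<close>.\<close>
    define C where "C = 2 * (L / 6 * norm (u + v) ^ 3 + L / 6 * norm u ^ 3 + L / 2 * (norm u)\<^sup>2 * norm v
       + L / 6 * norm v ^ 3 + L / 2 * norm u * (norm v)\<^sup>2)"
    have "0 \<le> inner u (hessian f x v) - inner v (hessian f x u)"
    proof (rule first_order_coeff_nonneg)
      fix s :: real assume s: "0 < s" "s \<le> 1"
      define x' where "x' = x + s *\<^sub>R u"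
      have "x' + s *\<^sub>R v = x + s *\<^sub>R (u + v)" by (simp add: x'_def algebra_simps)
      then have "\<bar>f (x' + s *\<^sub>R v) - taylor2 f x (x + s *\<^sub>R (u + v))\<bar> \<le> s ^ 3 * (L / 6 * norm (u + v) ^ 3)"
        using taylor2_bound[of "x + s *\<^sub>R (u + v)" x] s by (simp add: power_mult_distrib mult.left_commute)
      moreover have "\<bar>f x' - taylor2 f x x'\<bar> \<le> s ^ 3 * (L / 6 * norm u ^ 3)"
        using taylor2_bound[of x' x] s by (simp add: x'_def power_mult_distrib mult.left_commute)
      moreover have "\<bar>f (x' + s *\<^sub>R v) - taylor2 f x' (x' + s *\<^sub>R v)\<bar> \<le> s ^ 3 * (L / 6 * norm v ^ 3)"
        using taylor2_bound[of "x' + s *\<^sub>R v" x'] s by (simp add: power_mult_distrib mult.left_commute)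
      moreover have "\<bar>s * inner v (gradient f x' - gradient f x - s *\<^sub>R hessian f x u)\<bar>
          \<le> s ^ 3 * (L / 2 * (norm u)\<^sup>2 * norm v)"
      proof -
        have "\<bar>inner v (gradient f x' - gradient f x - s *\<^sub>R hessian f x u)\<bar>
          \<le> norm v * norm (gradient f x' - gradient f x - s *\<^sub>R hessian f x u)"
          by (rule Cauchy_Schwarz_ineq2)
        also have "\<dots> \<le> norm v * (L / 2 * (norm (s *\<^sub>R u))\<^sup>2)"
          using gradient_taylor[of x' x]
          by (intro mult_left_mono) (auto simp: x'_def blinfun.scaleR_right)
        finally show ?thesis
          using s by (simp add: abs_mult power_mult_distrib power2_eq_square power3_eq_cube mult_ac)
      qed
      moreover have "\<bar>s\<^sup>2 / 2 * inner v (hessian f x' v - hessian f x v)\<bar>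
          \<le> s ^ 3 * (L / 2 * norm u * (norm v)\<^sup>2)"
      proof -
        have "\<bar>inner v (hessian f x' v - hessian f x v)\<bar> \<le> norm v * norm (hessian f x' v - hessian f x v)"
          by (rule Cauchy_Schwarz_ineq2)
        also have "\<dots> \<le> norm v * (L * norm (s *\<^sub>R u) * norm v)"
          using hessian_diff_bound[of x' v x]
          by (intro mult_left_mono) (auto simp: x'_def)
        finally have "s\<^sup>2 / 2 * \<bar>inner v (hessian f x' v - hessian f x v)\<bar>
           \<le> s\<^sup>2 / 2 * (norm v * (L * norm (s *\<^sub>R u) * norm v))"
          by (rule mult_left_mono) simp
        then show ?thesis
          using s by (simp add: abs_mult power2_eq_square power3_eq_cube mult_ac)
      qed
      moreover have "taylor2 f x x' = f x + s * inner u (gradient f x) + s\<^sup>2 / 2 * inner u (hessian f x u)"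
        unfolding x'_def by (rule taylor2_line)
      moreover have "taylor2 f x (x + s *\<^sub>R (u + v)) = f x + s * inner u (gradient f x)
        + s * inner v (gradient f x) + s\<^sup>2 / 2 * inner u (hessian f x u) + s\<^sup>2 / 2 * inner v (hessian f x v)
        + s\<^sup>2 / 2 * inner u (hessian f x v) + s\<^sup>2 / 2 * inner v (hessian f x u)"
        unfolding taylor2_line by (simp add: inner_add_left inner_add_right blinfun.add_right algebra_simps)
      moreover have "taylor2 f x' (x' + s *\<^sub>R v) = f x' + s * inner v (gradient f x)
        + s\<^sup>2 * inner v (hessian f x u) + s * inner v (gradient f x' - gradient f x - s *\<^sub>R hessian f x u)
        + s\<^sup>2 / 2 * inner v (hessian f x v) + s\<^sup>2 / 2 * inner v (hessian f x' v - hessian f x v)"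
        unfolding taylor2_line by (simp add: inner_diff_right algebra_simps power2_eq_square)
      ultimately have "0 \<le> s\<^sup>2 / 2 * inner u (hessian f x v) - s\<^sup>2 / 2 * inner v (hessian f x u)
        + (s ^ 3 * (L / 6 * norm (u + v) ^ 3) + s ^ 3 * (L / 6 * norm u ^ 3) + s ^ 3 * (L / 2 * (norm u)\<^sup>2 * norm v)
           + s ^ 3 * (L / 6 * norm v ^ 3) + s ^ 3 * (L / 2 * norm u * (norm v)\<^sup>2))"
        unfolding abs_le_iff by linarith
      also have "\<dots> = s / 2 * (s * (inner u (hessian f x v) - inner v (hessian f x u)) + C * s\<^sup>2)"
        unfolding C_def by (simp add: power2_eq_square power3_eq_cube algebra_simps)
      finally show "0 \<le> s * (inner u (hessian f x v) - inner v (hessian f x u)) + C * s\<^sup>2"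
        using s by (simp add: zero_le_mult_iff)
    qed
    then show ?thesis by simp
  qed
  show ?thesis by (rule antisym[OF le le])
qed

text \<open>The polynomial centred at \<open>xt\<close> is expanded exactly around another point
  \<open>x\<close>. The two cross terms are equal by symmetry of the Hessian, which identifies
  \<open>gradient f xt + hessian f xt (x - xt)\<close> as the gradient of the model.\<close>

lemma taylor2_add:
  "taylor2 f xt (x + d) = taylor2 f xt x + inner d (gradient f xt + hessian f xt (x - xt))
     + inner d (hessian f xt d) / 2"
proof -
  have "x + d - xt = (x - xt) + d" by simp
  then show ?thesis
    unfolding taylor2_def using hessian_symmetric[of d xt "x - xt"]
    by (simp only: blinfun.add_right inner_add_left inner_add_right)
      (simp add: inner_commute field_simps)
qed

end

section \<open>Optimality conditions of the quadratic model\<close>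

lemma inner_nonneg_vec:
  fixes u v :: "real^'m"
  assumes "0 \<le> u" "0 \<le> v"
  shows "0 \<le> inner u v"
  using assms by (auto simp: inner_vec_def less_eq_vec_def intro!: sum_nonneg)

locale convex_program =
  fixes f :: "real^'n \<Rightarrow> real" and g :: "real^'n \<Rightarrow> real^'m" and L0 :: real and Lg :: "real^'m"
  assumes standing: "standing_assumptions f g L0 Lg"
begin

sublocale f: lipschitz_hessian f L0
  using standing by unfold_locales (auto simp: standing_assumptions_def)

sublocale g: lipschitz_hessian "\<lambda>x. g x $ i" "Lg $ i" for i
  using standing by unfold_locales (auto simp: standing_assumptions_def)

lemma Lg_nonneg: "0 \<le> Lg"
  using g.L_nonneg by (simp add: less_eq_vec_def)

lemma norm_Lg_pos: "0 < norm Lg"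
  using standing by (auto simp: standing_assumptions_def)

lemma saddle_op_eq:
  "saddle_op f g (x, y) = (gradient f x + (\<Sum>i\<in>UNIV. y $ i *\<^sub>R gradient (\<lambda>u. g u $ i) x), - g x)"
proof -
  have "gradient_matrix g x *v y = (\<Sum>i\<in>UNIV. y $ i *\<^sub>R gradient (\<lambda>u. g u $ i) x)"
    by (simp add: vec_eq_iff matrix_vector_mult_def gradient_matrix_def mult.commute)
  then show ?thesis by (simp add: saddle_op_def)
qed

text \<open>The \<open>x\<close>-gradient of the quadratic model of the Lagrangian centred at
  \<open>xt\<close>, written out explicitly; \<open>model_add\<close> justifies this reading, and
  \<open>model_hessian_form\<close> is the corresponding second-order form.\<close>

definition model_gradient :: "real^'n \<Rightarrow> real^'n \<Rightarrow> real^'m \<Rightarrow> real^'n" where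
  "model_gradient xt x y = gradient f xt + hessian f xt (x - xt)
     + (\<Sum>i\<in>UNIV. y $ i *\<^sub>R (gradient (\<lambda>u. g u $ i) xt + hessian (\<lambda>u. g u $ i) xt (x - xt)))"

definition model_hessian_form :: "real^'n \<Rightarrow> real^'m \<Rightarrow> real^'n \<Rightarrow> real" where
  "model_hessian_form xt y d = inner d (hessian f xt d)
     + (\<Sum>i\<in>UNIV. y $ i * inner d (hessian (\<lambda>u. g u $ i) xt d))"

lemma model_hessian_form_nonneg: "0 \<le> y \<Longrightarrow> 0 \<le> model_hessian_form xt y d"
  using standing unfolding model_hessian_form_def standing_assumptions_def
  by (intro add_nonneg_nonneg sum_nonneg mult_nonneg_nonneg f.hessian_psd g.hessian_psd)
    (auto simp: less_eq_vec_def)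

lemma model_add:
  "taylor2 f xt (x + d) + inner y (taylor2_vec g xt (x + d))
    = taylor2 f xt x + inner y (taylor2_vec g xt x) + inner d (model_gradient xt x y)
      + model_hessian_form xt y d / 2"
  unfolding model_gradient_def model_hessian_form_def inner_vec_def[of y] taylor2_vec_def vec_lambda_beta
    f.taylor2_add g.taylor2_add
  by (simp add: inner_add_right inner_sum_right algebra_simps sum.distrib flip: sum_divide_distrib)

lemma model_monotone:
  assumes "0 \<le> y" "0 \<le> y'"
  shows "inner (y - y') (taylor2_vec g xt x - taylor2_vec g xt x')
    \<le> inner (x - x') (model_gradient xt x y - model_gradient xt x' y')"
  using model_add[of xt x "x' - x" y] model_add[of xt x' "x - x'" y']
    model_hessian_form_nonneg[OF assms(1), of xt "x' - x"]
    model_hessian_form_nonneg[OF assms(2), of xt "x - x'"]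
  by (simp add: inner_diff_left inner_diff_right)

lemma model_gradient_center: "model_gradient x x y = fst (saddle_op f g (x, y))"
  by (simp add: model_gradient_def saddle_op_eq)

lemma model_gradient_error:
  assumes "0 \<le> y"
  shows "norm (fst (saddle_op f g (x, y)) - model_gradient xt x y)
    \<le> (L0 + inner Lg y) / 2 * (norm (x - xt))\<^sup>2"
proof -
  have "fst (saddle_op f g (x, y)) - model_gradient xt x y
    = (gradient f x - gradient f xt - hessian f xt (x - xt))
      + (\<Sum>i\<in>UNIV. y $ i *\<^sub>R (gradient (\<lambda>u. g u $ i) x - gradient (\<lambda>u. g u $ i) xt
           - hessian (\<lambda>u. g u $ i) xt (x - xt)))"
    by (simp add: saddle_op_eq model_gradient_def scaleR_diff_right scaleR_add_right sum.distrib
        sum_subtractf)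
  also have "norm \<dots> \<le> L0 / 2 * (norm (x - xt))\<^sup>2
      + (\<Sum>i\<in>UNIV. y $ i * (Lg $ i / 2 * (norm (x - xt))\<^sup>2))"
  proof (intro norm_triangle_mono f.gradient_taylor sum_norm_le)
    fix i
    have "0 \<le> y $ i" using assms by (simp add: less_eq_vec_def)
    then show "norm (y $ i *\<^sub>R (gradient (\<lambda>u. g u $ i) x - gradient (\<lambda>u. g u $ i) xt
           - hessian (\<lambda>u. g u $ i) xt (x - xt))) \<le> y $ i * (Lg $ i / 2 * (norm (x - xt))\<^sup>2)"
      by (simp only: norm_scaleR abs_of_nonneg mult_left_mono[OF g.gradient_taylor])
  qed
  also have "\<dots> = (L0 + inner Lg y) / 2 * (norm (x - xt))\<^sup>2"
    unfolding inner_vec_def inner_real_def add_divide_distrib distrib_right sum_divide_distrib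
      sum_distrib_right by (simp add: mult_ac)
  finally show ?thesis .
qed

lemma taylor2_vec_error:
  "norm (g x - taylor2_vec g xt x) \<le> norm Lg / 6 * norm (x - xt) ^ 3"
proof -
  have "norm (g x - taylor2_vec g xt x) \<le> norm ((norm (x - xt) ^ 3 / 6) *\<^sub>R Lg)"
  proof (rule norm_le_componentwise_cart)
    fix i
    show "norm ((g x - taylor2_vec g xt x) $ i) \<le> norm (((norm (x - xt) ^ 3 / 6) *\<^sub>R Lg) $ i)"
      using g.taylor2_bound[of x i xt] g.L_nonneg[of i]
      by (simp add: taylor2_vec_def abs_mult mult.commute)
  qed
  then show ?thesis by (simp add: mult.commute)
qed

text \<open>The marginal function of the min-max problem need not be differentiated: strong concavity in
  \<open>y\<close> bounds it from above by the smooth function \<open>F x' y + lam / 2 * \<parallel>G x' - G x\<parallel>\<^sup>2\<close>, which touches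
  it at \<open>x\<close>, so \<open>x\<close> is a critical point of the latter.\<close>
lemma min_max_optimality:
  assumes lam: "0 < lam"
    and sol: "solves_min_max (subproblem_obj f g xt (x0, y0) lam) (x, y)"
  defines "w \<equiv> inverse lam *\<^sub>R (y - y0) - taylor2_vec g xt x"
  shows "0 \<le> y" and "0 \<le> w" and "inner y w = 0"
    and "model_gradient xt x y + inverse lam *\<^sub>R (x - x0) = 0"
proof -
  define F where "F = subproblem_obj f g xt (x0, y0) lam"
  define G where "G = taylor2_vec g xt"
  have y: "0 \<le> y" and argmax: "\<And>y'. 0 \<le> y' \<Longrightarrow> F x y' \<le> F x y"
    using sol by (auto simp: solves_min_max_def is_arg_max_def F_def not_less)
  have argmin: "(SUP y\<in>{0..}. F x y) \<le> (SUP y\<in>{0..}. F x' y)" for x'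
    using sol by (auto simp: solves_min_max_def is_arg_min_def F_def not_less)
  \<comment> \<open>\<open>F x'\<close> is quadratic in the multiplier, so this expansion around
    \<open>y\<close> is exact for every \<open>x'\<close>.\<close>
  have Fy: "F x' y' = F x' y + inner (y' - y) (G x') - inner (y' - y) (inverse lam *\<^sub>R (y - y0))
      - (norm (y' - y))\<^sup>2 / (2 * lam)" for x' y'
  proof -
    have "y' - y0 = (y' - y) + (y - y0)" by simp
    then have eq: "(norm (y' - y0))\<^sup>2 = (norm (y' - y))\<^sup>2 + (norm (y - y0))\<^sup>2 + 2 * inner (y' - y) (y - y0)"
      unfolding power2_norm_eq_inner
      by (simp only: inner_add_left inner_add_right) (simp add: inner_commute)
    show ?thesis
      unfolding F_def G_def subproblem_obj_def inner_scaleR_right snd_conv eq using lam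
      by (simp add: field_simps inner_diff_left)
  qed
  \<comment> \<open>\<open>w\<close> is the negative gradient of \<open>F x\<close> at
    \<open>y\<close>. Moving along a coordinate axis will give \<open>0 \<le> w\<close>, and
    shrinking \<open>y\<close> towards 0 will give complementarity.\<close>
  have argmax': "0 \<le> inner (y' - y) w + (norm (y' - y))\<^sup>2 / (2 * lam)" if "0 \<le> y'" for y'
    using argmax[OF that] Fy[of x y'] by (simp add: w_def G_def inner_diff_right)
  show "0 \<le> y" by (rule y)
  show w: "0 \<le> w"
  proof (simp add: less_eq_vec_def, rule)
    fix i
    show "0 \<le> w $ i"
    proof (rule first_order_coeff_nonneg)
      fix s :: real assume s: "0 < s" "s \<le> 1"
      have "0 \<le> y + s *\<^sub>R axis i 1"
        using y s by (auto simp: less_eq_vec_def axis_def)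
      from argmax'[OF this] show "0 \<le> s * w $ i + 1 / (2 * lam) * s\<^sup>2"
        using s by (simp add: inner_axis' power_mult_distrib)
    qed
  qed
  have "0 \<le> - inner y w"
  proof (rule first_order_coeff_nonneg)
    fix s :: real assume s: "0 < s" "s \<le> 1"
    have "0 \<le> y - s *\<^sub>R y"
      using y s by (auto simp: less_eq_vec_def mult_left_le_one_le)
    from argmax'[OF this] show "0 \<le> s * (- inner y w) + (norm y)\<^sup>2 / (2 * lam) * s\<^sup>2"
      using s by (simp add: power_mult_distrib mult.commute)
  qed
  then show yw: "inner y w = 0" using inner_nonneg_vec[OF y w] by simp
  have sup_x: "(SUP y\<in>{0..}. F x y) = F x y"
    using y argmax by (intro cSup_eq_maximum) auto
  have min_x: "F x y \<le> F x' y + lam / 2 * (norm (G x' - G x))\<^sup>2" for x'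
  proof -
    have "(SUP y\<in>{0..}. F x' y) \<le> F x' y + lam / 2 * (norm (G x' - G x))\<^sup>2"
    proof (rule cSUP_least)
      fix y' :: "real^'m" assume "y' \<in> {0..}"
      then have "0 \<le> inner y' w" using w by (simp add: inner_nonneg_vec)
      define e where "e = y' - y"
      have "F x' y' = F x' y - inner e w + inner e (G x' - G x) - (norm e)\<^sup>2 / (2 * lam)"
        by (subst Fy) (simp add: w_def G_def e_def inner_diff_right)
      moreover have "0 \<le> inner e w" using yw \<open>0 \<le> inner y' w\<close> by (simp add: e_def inner_diff_left)
      \<comment> \<open>Young's inequality, with weights chosen so that the first term cancels the
        strongly concave one.\<close>
      moreover have "inner e (G x' - G x) \<le> (norm e)\<^sup>2 / (2 * lam) + lam / 2 * (norm (G x' - G x))\<^sup>2"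
      proof -
        have "0 \<le> (norm (e - lam *\<^sub>R (G x' - G x)))\<^sup>2 / (2 * lam)" using lam by simp
        also have "(norm (e - lam *\<^sub>R (G x' - G x)))\<^sup>2
          = (norm e)\<^sup>2 - 2 * lam * inner e (G x' - G x) + lam\<^sup>2 * (norm (G x' - G x))\<^sup>2"
          unfolding power2_norm_eq_inner
          by (simp add: inner_diff_left inner_diff_right inner_commute power2_eq_square algebra_simps)
        finally show ?thesis using lam by (simp add: field_simps power2_eq_square)
      qed
      ultimately show "F x' y' \<le> F x' y + lam / 2 * (norm (G x' - G x))\<^sup>2" by linarith
    qed (auto intro: exI[of _ 0])
    then show ?thesis using argmin[of x'] sup_x by simp
  qed
  define p where "p = model_gradient xt x y + inverse lam *\<^sub>R (x - x0)"
  \<comment> \<open>Along \<open>x + s *\<^sub>R (- p)\<close> the constraint model changes by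
    exactly \<open>s *\<^sub>R (A + s *\<^sub>R B)\<close>, so the squared change enters only at
    order \<open>s\<^sup>2\<close>. The direction \<open>- p\<close> turns the first-order condition
    into \<open>0 \<le> - inner p p\<close>.\<close>
  define A where "A = (\<chi> i. inner (- p) (gradient (\<lambda>u. g u $ i) xt + hessian (\<lambda>u. g u $ i) xt (x - xt)))"
  define B where "B = (\<chi> i. inner (- p) (hessian (\<lambda>u. g u $ i) xt (- p)) / 2)"
  define C where "C = model_hessian_form xt y (- p) / 2 + (norm p)\<^sup>2 / (2 * lam)
    + lam / 2 * (norm A + norm B)\<^sup>2"
  have "0 \<le> inner (- p) p"
  proof (rule first_order_coeff_nonneg)
    fix s :: real assume s: "0 < s" "s \<le> 1"
    define d where "d = s *\<^sub>R (- p)"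
    have "G (x + d) - G x = s *\<^sub>R (A + s *\<^sub>R B)"
      unfolding vec_eq_iff G_def taylor2_vec_def vec_lambda_beta vector_minus_component g.taylor2_add
      by (simp add: A_def B_def d_def blinfun.minus_right blinfun.scaleR_right algebra_simps)
    moreover have "norm (A + s *\<^sub>R B) \<le> norm A + norm B"
      using s norm_triangle_ineq[of A "s *\<^sub>R B"] mult_left_le_one_le[of "norm B" s] by simp
    ultimately have "norm (G (x + d) - G x) \<le> s * (norm A + norm B)"
      using s by simp
    then have "(norm (G (x + d) - G x))\<^sup>2 \<le> (s * (norm A + norm B))\<^sup>2"
      by (rule power_mono) simp
    then have "lam / 2 * (norm (G (x + d) - G x))\<^sup>2 \<le> lam / 2 * (s * (norm A + norm B))\<^sup>2"
      using lam by (intro mult_left_mono) auto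
    moreover have "F (x + d) y = F x y + inner d p + model_hessian_form xt y d / 2 + (norm d)\<^sup>2 / (2 * lam)"
    proof -
      have "x + d - x0 = (x - x0) + d" by simp
      then have eq: "(norm (x + d - x0))\<^sup>2 = (norm (x - x0))\<^sup>2 + 2 * inner d (x - x0) + (norm d)\<^sup>2"
        unfolding power2_norm_eq_inner by (simp only: inner_add_left inner_add_right) (simp add: inner_commute)
      show ?thesis
        unfolding F_def subproblem_obj_def model_add p_def fst_conv eq inner_add_right inner_scaleR_right
        using lam
        by (simp add: field_simps inner_add_right)
    qed
    moreover have "model_hessian_form xt y d = s\<^sup>2 * model_hessian_form xt y (- p)"
      by (simp add: model_hessian_form_def d_def blinfun.scaleR_right blinfun.minus_right
          power2_eq_square sum_distrib_left algebra_simps)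
    ultimately have "0 \<le> inner d p + s\<^sup>2 * model_hessian_form xt y (- p) / 2 + (norm d)\<^sup>2 / (2 * lam)
        + lam / 2 * (s * (norm A + norm B))\<^sup>2"
      using min_x[of "x + d"] by simp
    also have "\<dots> = s * inner (- p) p + C * s\<^sup>2"
      unfolding C_def d_def power_mult_distrib
      using s by (simp add: power_mult_distrib algebra_simps)
    finally show "0 \<le> s * inner (- p) p + C * s\<^sup>2" .
  qed
  then have "p = 0" by (simp flip: power2_norm_eq_inner)
  then show "model_gradient xt x y + inverse lam *\<^sub>R (x - x0) = 0" by (simp add: p_def)
qed

end

section \<open>The neighbourhoods of inexact solutions\<close>

text \<open>Only \<open>s\<close> is restricted in sign while \<open>r\<close> ranges over all
  reals, so that a positive root is seen to dominate every real root.\<close>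

lemma quadratic_increasing:
  fixes a b r s :: real
  assumes "0 < a" "0 \<le> b" "0 \<le> s" "(b + a * r) * r \<le> (b + a * s) * s"
  shows "r \<le> s"
proof (rule ccontr)
  assume "\<not> r \<le> s"
  then have "b * s \<le> b * r" "s * s < r * r"
    using assms by (auto intro: mult_left_mono mult_strict_mono')
  moreover have "a * (s * s) < a * (r * r)"
    using calculation assms by (intro mult_strict_left_mono) auto
  ultimately show False
    using assms(4) unfolding distrib_right mult.assoc by linarith
qed

text \<open>The rationalized form of the quadratic formula, in the shape in which
  \<open>rhobar\<close> is given. The equation is checked after multiplication by
  \<open>(b + S)\<^sup>2\<close>.\<close>

lemma quadratic_positive_root:
  fixes a b \<alpha> :: real
  assumes "0 < a" "0 \<le> b" "0 < \<alpha>"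
  defines "r \<equiv> 2 * \<alpha> / (b + sqrt (b\<^sup>2 + 4 * a * \<alpha>))"
  shows "0 < r" "(b + a * r) * r = \<alpha>"
proof -
  define S where "S = sqrt (b\<^sup>2 + 4 * a * \<alpha>)"
  have S: "S\<^sup>2 = b\<^sup>2 + 4 * a * \<alpha>" "0 < S"
    using assms by (auto simp: S_def intro!: add_nonneg_pos)
  show "0 < r" using assms S by (auto simp: r_def simp flip: S_def intro!: divide_pos_pos add_nonneg_pos)
  have r: "r * (b + S) = 2 * \<alpha>" using assms S by (simp add: r_def flip: S_def)
  have "(b + a * r) * r * (b + S)\<^sup>2 = b * (r * (b + S)) * (b + S) + a * (r * (b + S))\<^sup>2"
    by (simp add: power2_eq_square algebra_simps)
  also have "\<dots> = \<alpha> * (b\<^sup>2 + 2 * b * S + (b\<^sup>2 + 4 * a * \<alpha>))"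
    unfolding r by (simp add: power2_eq_square algebra_simps)
  also have "\<dots> = \<alpha> * (b + S)\<^sup>2"
    unfolding S(1)[symmetric] by (simp add: power2_eq_square algebra_simps)
  finally show "(b + a * r) * r = \<alpha>" using S(2) assms(2) by simp
qed

lemma neg_part_nonneg: "0 \<le> neg_part v"
  by (simp add: neg_part_def less_eq_vec_def)

lemma power2_norm_Pair: "(norm (x, y))\<^sup>2 = (norm x)\<^sup>2 + (norm y)\<^sup>2"
  by (simp add: norm_Pair)

text \<open>Any feasible \<open>w\<close> bounds the residual from above. Hence an old
  \<open>w\<close> can be reused after \<open>lam\<close> or the center has changed, and the
  multiplier of the min-max problem can be used after a Newton step.\<close>

lemma Psi_le:
  assumes "0 < lam" "0 \<le> snd z" "0 \<le> w"
  shows "Psi S z0 lam z \<le> (norm (lam *\<^sub>R (S z - (0, w)) + z - z0))\<^sup>2 + 2 * lam * inner (snd z) w"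
  unfolding Psi_def
proof (rule cINF_lower)
  show "bdd_below ((\<lambda>w. (norm (lam *\<^sub>R (S z - (0, w)) + z - z0))\<^sup>2 + 2 * lam * inner (snd z) w) ` {0..})"
    using assms by (intro bdd_belowI2[of _ 0]) (simp add: inner_nonneg_vec)
qed (use assms in simp)

text \<open>The objective separates into convex quadratics, one per coordinate of the multiplier. In
  their derivatives the terms with \<open>y\<close> cancel, so the clipped minimizer depends only on
  \<open>y0\<close> and the constraint value; this explains the formula for
  \<open>w_seq\<close>.\<close>

lemma Psi_eq:
  fixes S :: "(real^'n) \<times> (real^'m) \<Rightarrow> (real^'n) \<times> (real^'m)"
    and x x0 :: "real^'n" and y y0 :: "real^'m"
  assumes "0 < lam" "0 \<le> y"
  defines "w \<equiv> neg_part (inverse lam *\<^sub>R y0 - snd (S (x, y)))"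
  shows "Psi S (x0, y0) lam (x, y)
    = (norm (lam *\<^sub>R (S (x, y) - (0, w)) + (x, y) - (x0, y0)))\<^sup>2 + 2 * lam * inner y w"
proof (rule antisym)
  show "Psi S (x0, y0) lam (x, y)
    \<le> (norm (lam *\<^sub>R (S (x, y) - (0, w)) + (x, y) - (x0, y0)))\<^sup>2 + 2 * lam * inner y w"
    using Psi_le[of lam "(x, y)" w S "(x0, y0)"] assms(1,2) by (simp add: w_def neg_part_nonneg)
next
  obtain p G where S: "S (x, y) = (p, - G)" by (metis surj_pair minus_minus)
  have obj: "(norm (lam *\<^sub>R (S (x, y) - (0, u)) + (x, y) - (x0, y0)))\<^sup>2 + 2 * lam * inner (snd (x, y)) u
    = (norm (lam *\<^sub>R p + x - x0))\<^sup>2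
      + (\<Sum>i\<in>UNIV. (lam * (- G $ i - u $ i) + y $ i - y0 $ i)\<^sup>2 + 2 * lam * (y $ i * u $ i))" for u
  proof -
    have "(norm (lam *\<^sub>R (- G - u) + y - y0))\<^sup>2 = (\<Sum>i\<in>UNIV. (lam * (- G $ i - u $ i) + y $ i - y0 $ i)\<^sup>2)"
      unfolding power2_norm_eq_inner
      by (simp only: inner_vec_def inner_real_def power2_eq_square
          vector_add_component vector_minus_component vector_scaleR_component vector_uminus_component
          real_scaleR_def)
    then show ?thesis
      by (simp add: S power2_norm_Pair inner_vec_def sum.distrib sum_distrib_left)
  qed
  show "(norm (lam *\<^sub>R (S (x, y) - (0, w)) + (x, y) - (x0, y0)))\<^sup>2 + 2 * lam * inner y w
    \<le> Psi S (x0, y0) lam (x, y)"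
    unfolding Psi_def
  proof (rule cINF_greatest)
    fix u :: "real^'m" assume "u \<in> {0..}"
    have "(lam * (- G $ i - w $ i) + y $ i - y0 $ i)\<^sup>2 + 2 * lam * (y $ i * w $ i)
      \<le> (lam * (- G $ i - u $ i) + y $ i - y0 $ i)\<^sup>2 + 2 * lam * (y $ i * u $ i)" for i
    proof -
      have w: "w $ i = max (- (G $ i + inverse lam * y0 $ i)) 0"
        by (simp add: w_def S neg_part_def)
      have "0 \<le> u $ i" using \<open>u \<in> {0..}\<close> by (simp add: less_eq_vec_def)
      \<comment> \<open>Variational inequality for minimization over the half-line: either the
        derivative vanishes at \<open>w $ i\<close>, or \<open>w $ i = 0\<close> and the derivative
        there is positive.\<close>
      have "0 \<le> (u $ i - w $ i) * (lam * (G $ i + w $ i) + y0 $ i)"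
      proof (cases "G $ i + inverse lam * y0 $ i \<le> 0")
        case True
        then have "lam * (G $ i + w $ i) + y0 $ i = 0"
          using \<open>0 < lam\<close> by (simp add: w field_simps)
        then show ?thesis by simp
      next
        case False
        then have "0 \<le> lam * (G $ i + inverse lam * y0 $ i)" using \<open>0 < lam\<close> by simp
        also have "\<dots> = lam * G $ i + y0 $ i" using \<open>0 < lam\<close> by (simp add: field_simps)
        finally show ?thesis
          using False \<open>0 \<le> u $ i\<close> by (simp add: w)
      qed
      then have "0 \<le> 2 * lam * ((u $ i - w $ i) * (lam * (G $ i + w $ i) + y0 $ i)) + lam\<^sup>2 * (u $ i - w $ i)\<^sup>2"
        using \<open>0 < lam\<close> by simp
      then show ?thesis by (simp add: power2_eq_square algebra_simps)
    qed
    then show "(norm (lam *\<^sub>R (S (x, y) - (0, w)) + (x, y) - (x0, y0)))\<^sup>2 + 2 * lam * inner y w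
      \<le> (norm (lam *\<^sub>R (S (x, y) - (0, u)) + (x, y) - (x0, y0)))\<^sup>2 + 2 * lam * inner (snd (x, y)) u"
      using obj[of w] unfolding obj[of u] by (simp add: sum_mono)
  qed (auto intro: exI[of _ 0])
qed

lemma Psi_nonneg:
  assumes "0 < lam" "0 \<le> snd z"
  shows "0 \<le> Psi S z0 lam z"
  unfolding Psi_def using assms by (intro cINF_greatest) (auto intro: exI[of _ 0] simp: inner_nonneg_vec)

text \<open>The triangle inequality in the plane for \<open>(a, sqrt e)\<close> and
  \<open>(b, 0)\<close>.\<close>

lemma sqrt_add_square_le:
  fixes a b c e :: real
  assumes "0 \<le> a" "0 \<le> b" "0 \<le> e"
  shows "sqrt ((a + b)\<^sup>2 + e) \<le> sqrt (a\<^sup>2 + e) + b"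
proof (rule real_le_lsqrt)
  have "a \<le> sqrt (a\<^sup>2 + e)" using assms by (simp add: real_le_rsqrt)
  then have "2 * (a * b) \<le> 2 * (sqrt (a\<^sup>2 + e) * b)" using assms by (intro mult_left_mono mult_right_mono) auto
  moreover have "(sqrt (a\<^sup>2 + e))\<^sup>2 = a\<^sup>2 + e" using assms by simp
  ultimately show "(a + b)\<^sup>2 + e \<le> (sqrt (a\<^sup>2 + e) + b)\<^sup>2"
    unfolding power2_sum by linarith
qed (use assms in auto)

section \<open>The size function and its behaviour under changes of the center and of
  \<open>lam\<close>\<close>

context convex_program
begin

text \<open>The expression shared by \<open>nbhd\<close> and \<open>rho\<close>: it estimates the
  linearization error for a residual \<open>r\<close>, divided by one power of
  \<open>r\<close>.\<close>

definition size_fun :: "real^'m \<Rightarrow> real \<Rightarrow> real" where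
  "size_fun y r = ((L0 + inner Lg \<bar>y\<bar>) / 2 + 2 * norm Lg / 3 * r) * r"

lemma inner_Lg_abs_nonneg: "0 \<le> inner Lg \<bar>y\<bar>"
  using Lg_nonneg by (intro inner_nonneg_vec) (auto simp: less_eq_vec_def abs_vec_def)

lemma size_fun_cancel:
  assumes "0 \<le> s" "size_fun y r \<le> size_fun y s" shows "r \<le> s"
proof (rule quadratic_increasing)
  show "0 < 2 * norm Lg / 3" using norm_Lg_pos by simp
  show "0 \<le> (L0 + inner Lg \<bar>y\<bar>) / 2" using inner_Lg_abs_nonneg[of y] f.L_nonneg by simp
qed (use assms in \<open>simp_all only: size_fun_def\<close>)

lemma size_fun_eq: "size_fun y r = (L0 + inner Lg \<bar>y\<bar>) / 2 * r + 2 * norm Lg / 3 * r\<^sup>2"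
  by (simp only: size_fun_def distrib_right mult.assoc power2_eq_square)

lemma size_fun_mono:
  assumes "0 \<le> r" "r \<le> s" shows "size_fun y r \<le> size_fun y s"
  unfolding size_fun_eq
proof (rule add_mono)
  show "(L0 + inner Lg \<bar>y\<bar>) / 2 * r \<le> (L0 + inner Lg \<bar>y\<bar>) / 2 * s"
    by (rule mult_left_mono[OF assms(2)]) (use inner_Lg_abs_nonneg[of y] f.L_nonneg in simp)
  show "2 * norm Lg / 3 * r\<^sup>2 \<le> 2 * norm Lg / 3 * s\<^sup>2"
    by (rule mult_left_mono[OF power_mono[OF assms(2,1)]]) simp
qed

lemma size_fun_scale:
  assumes "1 \<le> q" "0 \<le> r" shows "size_fun y (q * r) \<le> q\<^sup>2 * size_fun y r"
proof -
  have "q * ((L0 + inner Lg \<bar>y\<bar>) / 2 * r) \<le> q\<^sup>2 * ((L0 + inner Lg \<bar>y\<bar>) / 2 * r)"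
  proof (rule mult_right_mono)
    show "q \<le> q\<^sup>2" using assms by (simp add: power2_eq_square)
    show "0 \<le> (L0 + inner Lg \<bar>y\<bar>) / 2 * r"
      using inner_Lg_abs_nonneg[of y] f.L_nonneg assms by simp
  qed
  then show ?thesis
    unfolding size_fun_eq distrib_left power_mult_distrib by (simp only: mult.left_commute[of q] mult.left_commute[of "q\<^sup>2"])
qed

text \<open>\<open>GREATEST\<close> is meaningful because the explicit positive root dominates all
  real roots.\<close>

lemma rho_root:
  assumes "0 < \<alpha>"
  shows "0 < rho L0 Lg y \<alpha>" and "size_fun y (rho L0 Lg y \<alpha>) = \<alpha>"
proof -
  have "0 < 2 * norm Lg / 3" "0 \<le> (L0 + inner Lg \<bar>y\<bar>) / 2"
    using norm_Lg_pos inner_Lg_abs_nonneg[of y] f.L_nonneg by auto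
  note root = quadratic_positive_root[OF this assms]
  define r where "r = 2 * \<alpha> / ((L0 + inner Lg \<bar>y\<bar>) / 2
    + sqrt (((L0 + inner Lg \<bar>y\<bar>) / 2)\<^sup>2 + 4 * (2 * norm Lg / 3) * \<alpha>))"
  have r: "0 < r" "size_fun y r = \<alpha>"
    unfolding size_fun_def r_def by (rule root)+
  have "rho L0 Lg y \<alpha> = r"
    unfolding rho_def size_fun_def[symmetric]
  proof (rule Greatest_equality)
    show "s \<le> r" if "size_fun y s = \<alpha>" for s
    proof (rule size_fun_cancel[where y = y])
      show "size_fun y s \<le> size_fun y r" unfolding r(2) that ..
    qed (use r(1) in simp)
  qed (rule r)
  with r show "0 < rho L0 Lg y \<alpha>" "size_fun y (rho L0 Lg y \<alpha>) = \<alpha>" by simp_all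
qed

lemma nbhd_iff:
  "z \<in> nbhd f g L0 Lg t z0 lam \<longleftrightarrow>
     0 \<le> snd z \<and> lam * size_fun (snd z) (sqrt (Psi (saddle_op f g) z0 lam z)) \<le> t"
  by (simp add: nbhd_def size_fun_def Let_def)

lemma nbhdI:
  assumes "0 < lam" "0 \<le> snd z" "Psi (saddle_op f g) z0 lam z \<le> r\<^sup>2" "0 \<le> r"
    and "lam * size_fun (snd z) r \<le> t"
  shows "z \<in> nbhd f g L0 Lg t z0 lam"
proof -
  have "sqrt (Psi (saddle_op f g) z0 lam z) \<le> r"
    using assms by (intro real_le_lsqrt) auto
  then have "size_fun (snd z) (sqrt (Psi (saddle_op f g) z0 lam z)) \<le> size_fun (snd z) r"
    using Psi_nonneg[OF assms(1,2)] by (intro size_fun_mono) simp_all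
  then have "lam * size_fun (snd z) (sqrt (Psi (saddle_op f g) z0 lam z)) \<le> lam * size_fun (snd z) r"
    using assms(1) by (intro mult_left_mono) auto
  also have "\<dots> \<le> t" by (rule assms)
  finally show ?thesis using assms(2) by (simp add: nbhd_iff)
qed

text \<open>Moving the center by \<open>(\<tau> * lam) *\<^sub>R v\<close> and shrinking
  \<open>lam\<close> by the factor \<open>1 - \<tau>\<close> leaves the vector
  \<open>lam *\<^sub>R v + (x, y) - (x0, y0)\<close> unchanged. With the same \<open>w\<close>, the
  complementarity term only decreases.\<close>

lemma nbhd_extragradient:
  assumes lam: "0 < lam" and \<tau>: "0 < \<tau>" "\<tau> < 1" and z: "(x, y) \<in> nbhd f g L0 Lg t (x0, y0) lam"
  defines "w \<equiv> neg_part (g x + inverse lam *\<^sub>R y0)"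
  shows "(x, y) \<in> nbhd f g L0 Lg t ((x0, y0) - (\<tau> * lam) *\<^sub>R (saddle_op f g (x, y) - (0, w))) ((1 - \<tau>) * lam)"
proof -
  define v where "v = saddle_op f g (x, y) - (0, w)"
  have y: "0 \<le> y" and t: "lam * size_fun y (sqrt (Psi (saddle_op f g) (x0, y0) lam (x, y))) \<le> t"
    using z by (auto simp: nbhd_iff)
  have w: "0 \<le> w" by (simp add: w_def neg_part_nonneg)
  have Psi: "Psi (saddle_op f g) (x0, y0) lam (x, y)
    = (norm (lam *\<^sub>R v + (x, y) - (x0, y0)))\<^sup>2 + 2 * lam * inner y w"
    using Psi_eq[OF lam y, of "saddle_op f g" x0 y0 x] by (simp add: v_def w_def saddle_op_eq add.commute)
  have P0: "0 \<le> Psi (saddle_op f g) (x0, y0) lam (x, y)" using lam y by (intro Psi_nonneg) auto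
  show ?thesis
    unfolding v_def[symmetric]
  proof (rule nbhdI[where r = "sqrt (Psi (saddle_op f g) (x0, y0) lam (x, y))"])
    have eq: "((1 - \<tau>) * lam) *\<^sub>R v + (x, y) - ((x0, y0) - (\<tau> * lam) *\<^sub>R v) = lam *\<^sub>R v + (x, y) - (x0, y0)"
      by (simp add: algebra_simps)
    have "2 * ((1 - \<tau>) * lam) * inner y w \<le> 2 * lam * inner y w"
      using lam \<tau> inner_nonneg_vec[OF y w] by (intro mult_right_mono) auto
    moreover have "Psi (saddle_op f g) ((x0, y0) - (\<tau> * lam) *\<^sub>R v) ((1 - \<tau>) * lam) (x, y)
        \<le> (norm (lam *\<^sub>R v + (x, y) - (x0, y0)))\<^sup>2 + 2 * ((1 - \<tau>) * lam) * inner y w"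
      using Psi_le[of "(1 - \<tau>) * lam" "(x, y)" w "saddle_op f g" "(x0, y0) - (\<tau> * lam) *\<^sub>R v",
          folded v_def, unfolded eq] y w \<tau> lam by simp
    ultimately show "Psi (saddle_op f g) ((x0, y0) - (\<tau> * lam) *\<^sub>R v) ((1 - \<tau>) * lam) (x, y)
        \<le> (sqrt (Psi (saddle_op f g) (x0, y0) lam (x, y)))\<^sup>2"
      unfolding real_sqrt_pow2[OF P0] unfolding Psi by linarith
    have "0 \<le> size_fun y (sqrt (Psi (saddle_op f g) (x0, y0) lam (x, y)))"
      using size_fun_mono[OF order_refl, of "sqrt (Psi (saddle_op f g) (x0, y0) lam (x, y))" y] P0
      by (simp add: size_fun_def)
    then have "(1 - \<tau>) * lam * size_fun y (sqrt (Psi (saddle_op f g) (x0, y0) lam (x, y)))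
        \<le> lam * size_fun y (sqrt (Psi (saddle_op f g) (x0, y0) lam (x, y)))"
      using lam \<tau> by (intro mult_right_mono) auto
    then show "(1 - \<tau>) * lam * size_fun (snd (x, y)) (sqrt (Psi (saddle_op f g) (x0, y0) lam (x, y))) \<le> t"
      using t by simp
  qed (use lam \<tau> y P0 in auto)
qed

lemma nbhd_residual:
  assumes lam: "0 < lam" and t: "0 < t" and z: "(x, y) \<in> nbhd f g L0 Lg t (x0, y0) lam"
  defines "w \<equiv> neg_part (g x + inverse lam *\<^sub>R y0)"
  shows "(norm (lam *\<^sub>R (saddle_op f g (x, y) - (0, w)) + (x, y) - (x0, y0)))\<^sup>2 + 2 * lam * inner y w
    \<le> (rho L0 Lg y (t / lam))\<^sup>2"
proof -
  define r where "r = rho L0 Lg y (t / lam)"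
  have r: "0 < r" "lam * size_fun y r = t"
    using rho_root[of "t / lam" y] lam t by (auto simp: r_def)
  have y: "0 \<le> y" and t: "lam * size_fun y (sqrt (Psi (saddle_op f g) (x0, y0) lam (x, y))) \<le> t"
    using z by (auto simp: nbhd_iff)
  have "sqrt (Psi (saddle_op f g) (x0, y0) lam (x, y)) \<le> r"
  proof (rule size_fun_cancel[where y = y])
    show "size_fun y (sqrt (Psi (saddle_op f g) (x0, y0) lam (x, y))) \<le> size_fun y r"
      using t lam unfolding r(2)[symmetric] by simp
  qed (use r(1) in simp)
  then have "Psi (saddle_op f g) (x0, y0) lam (x, y) \<le> r\<^sup>2" by (rule sqrt_le_D)
  then show ?thesis
    using Psi_eq[OF lam y, of "saddle_op f g" x0 y0 x] by (simp add: r_def w_def saddle_op_eq add.commute)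
qed

text \<open>Under the new parameter the residual vector is
  \<open>(1 + h) *\<^sub>R a - h *\<^sub>R D\<close>. Since the displacement \<open>D\<close> is at
  most \<open>r / \<sigma>\<close>, its size is at most
  \<open>(1 + h + h / \<sigma>) * r = q * r\<close>.\<close>

lemma nbhd_enlarge_lam:
  assumes lam: "0 < lam" and h: "0 < h" and \<sigma>: "0 < \<sigma>" and \<theta>: "0 < \<theta>"
    and h_eq: "\<theta> * (1 + h) * (1 + h * (1 + 1/\<sigma>))\<^sup>2 = 1"
    and z: "(x, y) \<in> nbhd f g L0 Lg (\<theta>\<^sup>2) (x0, y0) lam"
    and small: "\<sigma> * norm ((x, y) - (x0, y0)) \<le> rho L0 Lg y (\<theta>\<^sup>2 / lam)"
  shows "(x, y) \<in> nbhd f g L0 Lg \<theta> (x0, y0) ((1 + h) * lam)"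
proof -
  define w where "w = neg_part (g x + inverse lam *\<^sub>R y0)"
  define v where "v = saddle_op f g (x, y) - (0, w)"
  define r where "r = rho L0 Lg y (\<theta>\<^sup>2 / lam)"
  define q where "q = 1 + h * (1 + 1/\<sigma>)"
  define a where "a = lam *\<^sub>R v + (x, y) - (x0, y0)"
  define D where "D = (x, y) - (x0, y0)"
  have r: "0 < r" "lam * size_fun y r = \<theta>\<^sup>2"
    using rho_root[of "\<theta>\<^sup>2 / lam" y] lam \<theta> by (auto simp: r_def)
  have y: "0 \<le> y" using z by (simp add: nbhd_iff)
  have w: "0 \<le> w" by (simp add: w_def neg_part_nonneg)
  have yw: "0 \<le> 2 * lam * inner y w" using lam inner_nonneg_vec[OF y w] by simp
  have "(norm a)\<^sup>2 + 2 * lam * inner y w \<le> r\<^sup>2"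
    using nbhd_residual[OF lam _ z] \<theta> by (simp only: a_def v_def w_def r_def zero_less_power)
  then have a: "sqrt ((norm a)\<^sup>2 + 2 * lam * inner y w) \<le> r"
    by (rule real_le_lsqrt[rotated]) (use r(1) in simp)
  have "norm D * \<sigma> \<le> r" using small unfolding D_def r_def by (subst mult.commute)
  then have D: "norm D \<le> r / \<sigma>" using \<sigma> by (simp only: pos_le_divide_eq)
  have q: "1 \<le> q" using h \<sigma> by (simp add: q_def)
  show ?thesis
  proof (rule nbhdI[where r = "q * r"])
    have eq: "((1 + h) * lam) *\<^sub>R v + (x, y) - (x0, y0) = (1 + h) *\<^sub>R a - h *\<^sub>R D"
      by (simp add: a_def D_def algebra_simps)
    have "Psi (saddle_op f g) (x0, y0) ((1 + h) * lam) (x, y)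
        \<le> (norm ((1 + h) *\<^sub>R a - h *\<^sub>R D))\<^sup>2 + 2 * ((1 + h) * lam) * inner y w"
      using Psi_le[of "(1 + h) * lam" "(x, y)" w "saddle_op f g" "(x0, y0)", folded v_def, unfolded eq]
        lam h y w by simp
    also have "\<dots> \<le> ((1 + h) * norm a + h * norm D)\<^sup>2 + (1 + h)\<^sup>2 * (2 * lam * inner y w)"
    proof (rule add_mono)
      have "norm ((1 + h) *\<^sub>R a - h *\<^sub>R D) \<le> norm ((1 + h) *\<^sub>R a) + norm (h *\<^sub>R D)"
        by (rule norm_triangle_ineq4)
      then show "(norm ((1 + h) *\<^sub>R a - h *\<^sub>R D))\<^sup>2 \<le> ((1 + h) * norm a + h * norm D)\<^sup>2"
        using h by (intro power_mono) auto
      \<comment> \<open>The complementarity term carries only the factor \<open>1 + h\<close>; it is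
        granted the square so that \<open>(1 + h)\<^sup>2\<close> comes out of the root together
        with the norm.\<close>
      have "(1 + h) * (2 * lam * inner y w) \<le> (1 + h)\<^sup>2 * (2 * lam * inner y w)"
        using h yw by (intro mult_right_mono) (auto simp: power2_eq_square)
      then show "2 * ((1 + h) * lam) * inner y w \<le> (1 + h)\<^sup>2 * (2 * lam * inner y w)"
        by (simp only: mult.assoc mult.left_commute[of "1 + h" 2])
    qed
    also have "\<dots> \<le> (q * r)\<^sup>2"
    proof -
      have "sqrt (((1 + h) * norm a + h * norm D)\<^sup>2 + (1 + h)\<^sup>2 * (2 * lam * inner y w))
        \<le> sqrt (((1 + h) * norm a)\<^sup>2 + (1 + h)\<^sup>2 * (2 * lam * inner y w)) + h * norm D"
        using h yw by (intro sqrt_add_square_le) auto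
      also have "((1 + h) * norm a)\<^sup>2 + (1 + h)\<^sup>2 * (2 * lam * inner y w)
        = (1 + h)\<^sup>2 * ((norm a)\<^sup>2 + 2 * lam * inner y w)"
        by (simp add: power_mult_distrib distrib_left)
      also have "sqrt \<dots> = (1 + h) * sqrt ((norm a)\<^sup>2 + 2 * lam * inner y w)"
        using h by (simp add: real_sqrt_mult)
      also have "\<dots> + h * norm D \<le> (1 + h) * r + h * (r / \<sigma>)"
        using h a D by (intro add_mono mult_left_mono) auto
      also have "\<dots> = q * r" by (simp add: q_def algebra_simps)
      finally show ?thesis by (rule sqrt_le_D)
    qed
    finally show "Psi (saddle_op f g) (x0, y0) ((1 + h) * lam) (x, y) \<le> (q * r)\<^sup>2" .
    have "(1 + h) * lam * size_fun y (q * r) \<le> (1 + h) * lam * (q\<^sup>2 * size_fun y r)"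
      using size_fun_scale[OF q, of r y] r(1) h lam by (intro mult_left_mono) auto
    also have "\<dots> = (1 + h) * q\<^sup>2 * (lam * size_fun y r)" by (simp add: mult_ac)
    also have "\<dots> = \<theta> * (\<theta> * (1 + h) * q\<^sup>2)" unfolding r(2) by (simp add: power2_eq_square mult_ac)
    also have "\<dots> = \<theta>" using h_eq by (simp add: q_def)
    finally show "(1 + h) * lam * size_fun (snd (x, y)) (q * r) \<le> \<theta>" by simp
  qed (use lam h y q r(1) in auto)
qed

end

section \<open>Relative-error steps and the proximal-Newton step\<close>

text \<open>The changes \<open>dx\<close> and \<open>dy\<close> share the budget
  \<open>R\<^sup>2\<close>. Therefore the cubic error of the constraints, of weight
  \<open>1/36\<close>, is absorbed by the weight \<open>1/4\<close> of the multiplier change and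
  does not enlarge the final constant.\<close>

lemma newton_residual_bound:
  fixes A N R s dx dy e1 e2 :: real
  assumes "0 \<le> A" "0 \<le> N" "0 \<le> R" "0 \<le> dx" "0 \<le> dy" and D: "dx\<^sup>2 + dy\<^sup>2 \<le> R\<^sup>2"
    and e1: "0 \<le> e1" "e1 \<le> (A + N / 2 * dy) * dx\<^sup>2" and e2: "0 \<le> e2" "e2 \<le> N / 6 * dx ^ 3"
  shows "e1\<^sup>2 + e2\<^sup>2 \<le> ((A + N / 2 * R) * R\<^sup>2)\<^sup>2"
proof -
  have dy: "dy \<le> R" using D \<open>0 \<le> R\<close> by (intro power2_le_imp_le[of dy R]) (auto intro: order_trans[rotated])
  have dx: "dx\<^sup>2 \<le> R\<^sup>2" using D by (smt (verit) zero_le_power2)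
  have "e1\<^sup>2 \<le> ((A + N / 2 * dy) * dx\<^sup>2)\<^sup>2" by (rule power_mono[OF e1(2,1)])
  moreover have "e2\<^sup>2 \<le> (N / 6 * dx ^ 3)\<^sup>2" by (rule power_mono[OF e2(2,1)])
  moreover have "((A + N / 2 * dy) * dx\<^sup>2)\<^sup>2 + (N / 6 * dx ^ 3)\<^sup>2
      = (A\<^sup>2 + A * N * dy + N\<^sup>2 * (dy\<^sup>2 / 4 + dx\<^sup>2 / 36)) * (dx\<^sup>2)\<^sup>2"
    by (simp add: power2_eq_square power3_eq_cube algebra_simps)
  moreover have "\<dots> \<le> (A\<^sup>2 + A * N * R + N\<^sup>2 * (R\<^sup>2 / 4)) * (R\<^sup>2)\<^sup>2"
  proof (rule mult_mono)
    have "A * N * dy \<le> A * N * R" using assms dy by (simp add: mult_left_mono)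
    moreover have "dy\<^sup>2 / 4 + dx\<^sup>2 / 36 \<le> R\<^sup>2 / 4" using D zero_le_power2[of dx] by linarith
    then have "N\<^sup>2 * (dy\<^sup>2 / 4 + dx\<^sup>2 / 36) \<le> N\<^sup>2 * (R\<^sup>2 / 4)"
      by (rule mult_left_mono) simp
    ultimately show "A\<^sup>2 + A * N * dy + N\<^sup>2 * (dy\<^sup>2 / 4 + dx\<^sup>2 / 36) \<le> A\<^sup>2 + A * N * R + N\<^sup>2 * (R\<^sup>2 / 4)"
      by linarith
    show "(dx\<^sup>2)\<^sup>2 \<le> (R\<^sup>2)\<^sup>2" by (rule power_mono[OF dx]) simp
  qed (use assms in simp_all)
  moreover have "\<dots> = ((A + N / 2 * R) * R\<^sup>2)\<^sup>2"
    by (simp add: power2_eq_square algebra_simps)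
  ultimately show ?thesis by linarith
qed

text \<open>One step of the hybrid proximal extragradient method in an abstract inner product space:
  \<open>v\<close> stands for an approximate value of a monotone operator at \<open>zt\<close>,
  tested against a solution \<open>zs\<close>.\<close>

locale hpe_step =
  fixes v zt z zs :: "'a::real_inner" and lam eps \<sigma> :: real
  assumes monotone: "- eps \<le> inner v (zt - zs)"
    and error: "(norm (lam *\<^sub>R v + zt - z))\<^sup>2 + 2 * lam * eps \<le> \<sigma>\<^sup>2 * (norm (zt - z))\<^sup>2"
    and lam: "0 < lam" and eps: "0 \<le> eps" and \<sigma>: "0 < \<sigma>" "\<sigma> < 1"
begin

lemma error_norm: "norm (lam *\<^sub>R v + zt - z) \<le> \<sigma> * norm (zt - z)"
proof (rule power2_le_imp_le)
  have "0 \<le> 2 * lam * eps" using lam eps by simp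
  then show "(norm (lam *\<^sub>R v + zt - z))\<^sup>2 \<le> (\<sigma> * norm (zt - z))\<^sup>2"
    using error unfolding power_mult_distrib by linarith
qed (use \<sigma> in simp)

lemma norm_v: "lam * norm v \<le> (1 + \<sigma>) * norm (zt - z)"
proof -
  have "norm (lam *\<^sub>R v) = norm ((lam *\<^sub>R v + zt - z) - (zt - z))" by simp
  also have "\<dots> \<le> norm (lam *\<^sub>R v + zt - z) + norm (zt - z)" by (rule norm_triangle_ineq4)
  finally show ?thesis using error_norm lam by (simp add: distrib_right)
qed

lemma eps_bound: "2 * lam * eps \<le> \<sigma>\<^sup>2 * (norm (zt - z))\<^sup>2"
  using error zero_le_power2[of "norm (lam *\<^sub>R v + zt - z)"] by linarith

text \<open>Adding the error condition to twice \<open>lam\<close> times the monotonicity inequality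
  cancels \<open>eps\<close> and bounds \<open>2 * inner u b\<close> from below by
  \<open>(norm u)\<^sup>2 + (1 - \<sigma>\<^sup>2) * (norm D)\<^sup>2\<close>. The term with
  \<open>\<tau> * \<tau>\<close> in the expanded square is then absorbed since
  \<open>\<tau> \<le> 1\<close>.\<close>

lemma fejer:
  assumes "0 \<le> \<tau>" "\<tau> \<le> 1"
  shows "(norm (z - (\<tau> * lam) *\<^sub>R v - zs))\<^sup>2 \<le> (norm (z - zs))\<^sup>2 - \<tau> * (1 - \<sigma>\<^sup>2) * (norm (zt - z))\<^sup>2"
proof -
  define u b D where "u = lam *\<^sub>R v" and "b = z - zs" and "D = zt - z"
  have "(norm (u + D))\<^sup>2 = (norm u)\<^sup>2 + 2 * inner u D + (norm D)\<^sup>2"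
    by (simp add: power2_norm_eq_inner inner_add_left inner_add_right inner_commute)
  moreover have "(norm (u + D))\<^sup>2 + 2 * lam * eps \<le> \<sigma>\<^sup>2 * (norm D)\<^sup>2"
    using error by (simp add: u_def D_def add_diff_eq)
  ultimately have err: "(norm u)\<^sup>2 + 2 * inner u D + (norm D)\<^sup>2 + 2 * lam * eps \<le> \<sigma>\<^sup>2 * (norm D)\<^sup>2"
    by linarith
  have "lam * (- eps) \<le> lam * inner v (zt - zs)" using monotone lam by (intro mult_left_mono) auto
  also have "\<dots> = inner u b + inner u D" by (simp add: u_def b_def D_def inner_diff_right algebra_simps)
  finally have "(norm u)\<^sup>2 + (norm D)\<^sup>2 - \<sigma>\<^sup>2 * (norm D)\<^sup>2 \<le> 2 * inner u b" using err by linarith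
  then have "\<tau> * ((norm u)\<^sup>2 + (norm D)\<^sup>2 - \<sigma>\<^sup>2 * (norm D)\<^sup>2) \<le> \<tau> * (2 * inner u b)"
    using assms by (intro mult_left_mono)
  moreover have "\<tau> * (\<tau> * (norm u)\<^sup>2) \<le> \<tau> * (norm u)\<^sup>2"
    using assms by (intro mult_left_mono mult_left_le_one_le) auto
  moreover have "(norm (b - \<tau> *\<^sub>R u))\<^sup>2 = (norm b)\<^sup>2 - \<tau> * (2 * inner u b) + \<tau> * (\<tau> * (norm u)\<^sup>2)"
    by (simp add: power2_norm_eq_inner inner_diff_left inner_diff_right inner_commute)
  moreover have eq: "z - (\<tau> * lam) *\<^sub>R v - zs = b - \<tau> *\<^sub>R u" by (simp add: b_def u_def)
  ultimately show ?thesis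
    unfolding eq D_def[symmetric] b_def[symmetric] by (simp add: algebra_simps)
qed

lemma dist_solution: "norm (zt - zs) \<le> norm (z - zs) / sqrt (1 - \<sigma>\<^sup>2)"
proof -
  define P q B s where "P = norm (z - lam *\<^sub>R v - zs)" and "q = norm (zt - z)" and "B = norm (z - zs)"
    and "s = 1 - \<sigma>\<^sup>2"
  have s: "0 < s" using \<sigma> by (simp add: s_def power_less_one_iff abs_square_less_1)
  \<comment> \<open>The comparison point is the full extragradient step, that is
    \<open>\<tau> = 1\<close>, from which \<open>zt\<close> differs only by the error
    vector.\<close>
  have P: "P\<^sup>2 + s * q\<^sup>2 \<le> B\<^sup>2" using fejer[of 1] by (simp add: P_def q_def B_def s_def)
  have "zt - zs = (z - lam *\<^sub>R v - zs) + (lam *\<^sub>R v + zt - z)" by simp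
  then have "norm (zt - zs) \<le> P + norm (lam *\<^sub>R v + zt - z)"
    unfolding P_def using norm_triangle_ineq by metis
  then have le: "norm (zt - zs) \<le> P + \<sigma> * q" using error_norm by (simp add: q_def)
  \<comment> \<open>Cauchy-Schwarz for \<open>(P, \<surd>s q)\<close> and \<open>(1, \<sigma> / \<surd>s)\<close>, cleared of denominators\<close>
  have "0 \<le> (\<sigma> * P - s * q)\<^sup>2" by simp
  also have "\<dots> = (1 - s) * P\<^sup>2 - 2 * s * \<sigma> * P * q + s * s * q\<^sup>2"
    by (simp add: s_def power2_eq_square algebra_simps)
  also have "\<dots> = (P\<^sup>2 + s * q\<^sup>2) - s * (P + \<sigma> * q)\<^sup>2"
    by (simp add: s_def power2_eq_square algebra_simps)
  finally have "s * (P + \<sigma> * q)\<^sup>2 \<le> B\<^sup>2" using P by linarith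
  then have "(sqrt s * (P + \<sigma> * q))\<^sup>2 \<le> B\<^sup>2" using s by (simp add: power_mult_distrib)
  then have "sqrt s * (P + \<sigma> * q) \<le> B" by (rule power2_le_imp_le) (simp add: B_def)
  moreover have "sqrt s * norm (zt - zs) \<le> sqrt s * (P + \<sigma> * q)"
    using le s by (intro mult_left_mono) auto
  ultimately have "sqrt s * norm (zt - zs) \<le> B" by linarith
  then show ?thesis
    unfolding B_def[symmetric] s_def[symmetric] using s by (simp add: pos_le_divide_eq mult.commute)
qed

lemma step_length: "norm (zt - z) \<le> norm (z - zs) / sqrt (1 - \<sigma>\<^sup>2)"
proof -
  have s: "0 < 1 - \<sigma>\<^sup>2" using \<sigma> by (simp add: power_less_one_iff abs_square_less_1)
  have "0 \<le> (norm (z - (1 * lam) *\<^sub>R v - zs))\<^sup>2" by simp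
  also note fejer[of 1]
  finally have "(sqrt (1 - \<sigma>\<^sup>2) * norm (zt - z))\<^sup>2 \<le> (norm (z - zs))\<^sup>2"
    using s by (simp add: power_mult_distrib)
  then have "sqrt (1 - \<sigma>\<^sup>2) * norm (zt - z) \<le> norm (z - zs)" by (rule power2_le_imp_le) simp
  then show ?thesis using s by (simp add: pos_le_divide_eq mult.commute)
qed

end

section \<open>Approximate subgradients of the Lagrangian and the contraction of one Newton
  step\<close>

context convex_program
begin

lemma lagrangian_above_tangent:
  assumes "0 \<le> y"
  shows "inner (x' - x) (fst (saddle_op f g (x, y))) \<le> (f x' + inner y (g x')) - (f x + inner y (g x))"
proof -
  have "inner (x' - x) (gradient f x) \<le> f x' - f x"
    using f.above_tangent[of "x' - x" x] standing by (simp add: standing_assumptions_def)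
  moreover have "(\<Sum>i\<in>UNIV. y $ i * inner (x' - x) (gradient (\<lambda>u. g u $ i) x))
      \<le> (\<Sum>i\<in>UNIV. y $ i * (g x' $ i - g x $ i))"
    using g.above_tangent[of _ "x' - x" x] standing assms
    by (intro sum_mono mult_left_mono) (auto simp: standing_assumptions_def less_eq_vec_def)
  ultimately show ?thesis
    by (simp add: saddle_op_eq inner_add_right inner_sum_right inner_vec_def[of y] right_diff_distrib
        sum_subtractf)
qed

text \<open>Convexity handles \<open>x\<close>, and in the multiplier the Lagrangian is linear. Of
  the two terms produced by \<open>w\<close>, \<open>inner y w\<close> is paid for by the tolerance
  and \<open>inner y' w\<close> has the right sign.\<close>

lemma saddle_eps_subgradient:
  assumes "0 \<le> y" "0 \<le> w" "0 \<le> y'"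
  shows "inner (saddle_op f g (x, y) - (0, w)) ((x', y') - (x, y)) - inner y w
    \<le> (f x' + inner y (g x')) - (f x + inner y' (g x))"
  using lagrangian_above_tangent[OF assms(1), of x' x] inner_nonneg_vec[OF assms(3,2)]
  by (simp add: inner_prod_def inner_diff_left inner_diff_right inner_commute saddle_op_eq)

lemma saddle_eps_subdiff:
  assumes "0 \<le> y" "0 \<le> w"
  shows "saddle_op f g (x, y) - (0, w)
    \<in> eps_subdiff (inner y w) (\<lambda>(x', y'). Lbar f g x' y - Lbar f g x y') (x, y)"
  unfolding eps_subdiff_def
proof (intro CollectI conjI allI)
  fix u' :: "(real^'n) \<times> (real^'m)"
  obtain x' y' where u': "u' = (x', y')" by (cases u')
  show "(case (x, y) of (x', y') \<Rightarrow> Lbar f g x' y - Lbar f g x y')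
      + ereal (inner (saddle_op f g (x, y) - (0, w)) (u' - (x, y))) - ereal (inner y w)
    \<le> (case u' of (x', y') \<Rightarrow> Lbar f g x' y - Lbar f g x y')"
  \<comment> \<open>Outside the orthant \<open>Lbar f g x y'\<close> is minus infinity, so the
    right-hand side is plus infinity.\<close>
  proof (cases "0 \<le> y'")
    case True
    then show ?thesis
      using saddle_eps_subgradient[OF assms True, of x x'] assms
      by (simp add: u' Lbar_def)
  qed (use assms in \<open>simp add: u' Lbar_def\<close>)
qed (use assms in \<open>simp add: Lbar_def\<close>)

text \<open>A KKT point is a saddle point of the Lagrangian. Its two saddle inequalities make the
  right-hand side of \<open>saddle_eps_subgradient\<close> at \<open>zs\<close> nonpositive.\<close>

lemma saddle_KKT_monotone:
  assumes "0 \<le> y" "0 \<le> w" "zs \<in> KKT f g"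
  shows "- inner y w \<le> inner (saddle_op f g (x, y) - (0, w)) ((x, y) - zs)"
proof -
  obtain xs ys where zs: "zs = (xs, ys)" by (cases zs)
  have KKT: "fst (saddle_op f g (xs, ys)) = 0" "g xs \<le> 0" "0 \<le> ys" "inner ys (g xs) = 0"
    using assms(3) by (auto simp: zs KKT_def saddle_op_def)
  have "inner y (g xs) \<le> 0"
    using inner_nonneg_vec[OF assms(1), of "- g xs"] KKT(2) by (simp add: less_eq_vec_def)
  moreover have "f xs + inner ys (g xs) \<le> f x + inner ys (g x)"
    using lagrangian_above_tangent[OF KKT(3), of x xs] KKT(1) by simp
  moreover have "inner (saddle_op f g (x, y) - (0, w)) (zs - (x, y)) - inner y w
    \<le> (f xs + inner y (g xs)) - (f x + inner ys (g x))"
    using saddle_eps_subgradient[OF assms(1,2) KKT(3), of x xs] by (simp only: zs)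
  ultimately show ?thesis
    using KKT(4) unfolding inner_diff_right[of "saddle_op f g (x, y) - (0, w)"] by linarith
qed

text \<open>The linearized saddle operator is monotone, so the distance from \<open>(xt, yt)\<close> to the solution is
  at most the residual \<open>r\<close>; the new residual is only the Taylor error, of second order in \<open>r\<close>.\<close>
lemma newton_step:
  assumes lam: "0 < lam" and \<theta>: "0 < \<theta>" "\<theta> \<le> 1/4"
    and zt: "(xt, yt) \<in> nbhd f g L0 Lg \<theta> (x0, y0) lam"
    and sol: "solves_min_max (subproblem_obj f g xt (x0, y0) lam) (x, y)"
  shows "(x, y) \<in> nbhd f g L0 Lg (\<theta>\<^sup>2) (x0, y0) lam"
proof -
  define G where "G = taylor2_vec g xt x"
  define p where "p = model_gradient xt x y"
  define w where "w = inverse lam *\<^sub>R (y - y0) - G"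
  have opt: "0 \<le> y" "0 \<le> w" "inner y w = 0" "p + inverse lam *\<^sub>R (x - x0) = 0"
    unfolding w_def G_def p_def by (rule min_max_optimality[OF lam sol])+
  have "lam *\<^sub>R (p + inverse lam *\<^sub>R (x - x0)) = 0" unfolding opt(4) by simp
  then have "lam *\<^sub>R p + (x - x0) = 0" using lam by (simp add: scaleR_add_right)
  then have lam_p: "lam *\<^sub>R p = - (x - x0)" unfolding eq_neg_iff_add_eq_0 .
  have lam_w: "lam *\<^sub>R w = (y - y0) - lam *\<^sub>R G" using lam by (simp add: w_def scaleR_diff_right)
  define w0 where "w0 = neg_part (g xt + inverse lam *\<^sub>R y0)"
  define P where "P = fst (saddle_op f g (xt, yt))"
  define a1 where "a1 = lam *\<^sub>R P + xt - x0"
  define a2 where "a2 = lam *\<^sub>R (- g xt - w0) + yt - y0"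
  define r where "r = sqrt (Psi (saddle_op f g) (x0, y0) lam (xt, yt))"
  have yt: "0 \<le> yt" and size: "lam * size_fun yt r \<le> \<theta>"
    using zt by (auto simp: nbhd_iff r_def)
  have w0: "0 \<le> w0" by (simp add: w0_def neg_part_nonneg)
  have "0 \<le> Psi (saddle_op f g) (x0, y0) lam (xt, yt)" using lam yt by (intro Psi_nonneg) auto
  then have r: "0 \<le> r" "r\<^sup>2 = Psi (saddle_op f g) (x0, y0) lam (xt, yt)" by (auto simp: r_def)
  have r2: "r\<^sup>2 = (norm a1)\<^sup>2 + (norm a2)\<^sup>2 + 2 * lam * inner yt w0"
  proof -
    have "lam *\<^sub>R (saddle_op f g (xt, yt) - (0, w0)) + (xt, yt) - (x0, y0) = (a1, a2)"
      by (simp add: a1_def a2_def P_def saddle_op_eq)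
    then show ?thesis
      unfolding r(2) power2_norm_Pair[symmetric]
      using Psi_eq[OF lam yt, of "saddle_op f g" x0 y0 xt] by (simp add: w0_def saddle_op_eq add.commute)
  qed
  define dx dy where "dx = x - xt" and "dy = y - yt"
  have D: "(norm dx)\<^sup>2 + (norm dy)\<^sup>2 \<le> r\<^sup>2"
  proof -
    \<comment> \<open>The model is exact at its center, so \<open>a1 + dx\<close> and
      \<open>a2 + dy\<close> consist of \<open>lam\<close> times a difference of model operator
      values and, in the second component, \<open>lam *\<^sub>R (w - w0)\<close>.\<close>
    have eq1: "a1 + dx = lam *\<^sub>R (P - p)"
      by (simp add: a1_def dx_def scaleR_diff_right lam_p)
    have eq2: "a2 + dy = lam *\<^sub>R (G - g xt) + lam *\<^sub>R (w - w0)"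
      by (simp add: a2_def dy_def scaleR_diff_right lam_w)
    have "inner dy (G - g xt) \<le> inner dx (p - P)"
      using model_monotone[OF opt(1) yt, of xt x xt]
      by (simp add: G_def p_def P_def dx_def dy_def model_gradient_center taylor2_vec_def taylor2_def vec_lambda_eta)
    then have "lam * inner dy (G - g xt) \<le> lam * inner dx (p - P)" using lam by (rule mult_left_mono[OF _ less_imp_le])
    \<comment> \<open>Complementarity of \<open>(y, w)\<close> and nonnegativity leave only
      \<open>inner yt w0\<close>, which is contained in \<open>r\<^sup>2\<close>.\<close>
    moreover have "lam * inner dy (w - w0) \<le> lam * inner yt w0"
      using lam opt inner_nonneg_vec[OF opt(1) w0] inner_nonneg_vec[OF yt opt(2)]
      by (intro mult_left_mono) (auto simp: dy_def inner_diff_left inner_diff_right)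
    ultimately have "inner dx (a1 + dx) + inner dy (a2 + dy) \<le> lam * inner yt w0"
      unfolding eq1 eq2 by (simp add: inner_add_right inner_diff_right algebra_simps)
    \<comment> \<open>With \<open>a = (a1, a2)\<close> and \<open>d = (dx, dy)\<close>, twice
      \<open>inner d (a + d)\<close> equals
      \<open>(norm d)\<^sup>2 + (norm (a + d))\<^sup>2 - (norm a)\<^sup>2\<close>; dropping the
      middle square leaves the bound by \<open>r\<^sup>2\<close>.\<close>
    moreover have "0 \<le> (norm (a1 + dx))\<^sup>2 + (norm (a2 + dy))\<^sup>2" by simp
    ultimately show ?thesis
      unfolding r2 power2_norm_eq_inner by (simp add: inner_add_left inner_add_right inner_commute)
  qed
  define A where "A = (L0 + inner Lg yt) / 2"
  define N where "N = norm Lg"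
  have A: "0 \<le> A" using f.L_nonneg inner_nonneg_vec[OF Lg_nonneg yt] by (simp add: A_def)
  have N: "0 \<le> N" by (simp add: N_def)
  have y_le: "(L0 + inner Lg y) / 2 \<le> A + N / 2 * norm dy"
    using norm_cauchy_schwarz[of Lg dy]
    unfolding A_def N_def dy_def inner_diff_right add_divide_distrib by linarith
  define e1 e2 where "e1 = fst (saddle_op f g (x, y)) - p" and "e2 = g x - G"
  have "(norm e1)\<^sup>2 + (norm e2)\<^sup>2 \<le> ((A + N / 2 * r) * r\<^sup>2)\<^sup>2"
  proof (rule newton_residual_bound[OF A N r(1) norm_ge_zero norm_ge_zero D norm_ge_zero _ norm_ge_zero])
    have "norm e1 \<le> (L0 + inner Lg y) / 2 * (norm dx)\<^sup>2"
      unfolding e1_def p_def dx_def by (rule model_gradient_error[OF opt(1)])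
    also have "\<dots> \<le> (A + N / 2 * norm dy) * (norm dx)\<^sup>2" using y_le by (intro mult_right_mono) auto
    finally show "norm e1 \<le> (A + N / 2 * norm dy) * (norm dx)\<^sup>2" .
    show "norm e2 \<le> N / 6 * norm dx ^ 3"
      unfolding e2_def G_def N_def dx_def by (rule taylor2_vec_error)
  qed
  then have "lam\<^sup>2 * ((norm e1)\<^sup>2 + (norm e2)\<^sup>2) \<le> lam\<^sup>2 * ((A + N / 2 * r) * r\<^sup>2)\<^sup>2"
    by (rule mult_left_mono) simp
  moreover have "Psi (saddle_op f g) (x0, y0) lam (x, y) \<le> lam\<^sup>2 * ((norm e1)\<^sup>2 + (norm e2)\<^sup>2)"
  proof -
    have "lam *\<^sub>R (saddle_op f g (x, y) - (0, w)) + (x, y) - (x0, y0) = (lam *\<^sub>R e1, - (lam *\<^sub>R e2))"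
      using lam_p lam_w by (simp add: e1_def e2_def saddle_op_eq scaleR_diff_right algebra_simps)
    then show ?thesis
      using Psi_le[of lam "(x, y)" w "saddle_op f g" "(x0, y0)"] lam opt
      by (simp add: power2_norm_Pair power_mult_distrib distrib_left)
  qed
  ultimately have Psi: "Psi (saddle_op f g) (x0, y0) lam (x, y) \<le> (lam * ((A + N / 2 * r) * r\<^sup>2))\<^sup>2"
    by (simp add: power_mult_distrib)
  have "\<bar>yt\<bar> = yt" using yt by (simp add: vec_eq_iff less_eq_vec_def abs_vec_def)
  then have size': "lam * ((A + 2 * N / 3 * r) * r) \<le> \<theta>"
    using size by (simp only: size_fun_def A_def N_def)
  have "lam * ((A + N / 2 * r) * r\<^sup>2) \<le> lam * ((A + 2 * N / 3 * r) * r\<^sup>2)"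
    using lam N r(1) by (intro mult_left_mono mult_right_mono add_left_mono) auto
  also have "\<dots> = lam * ((A + 2 * N / 3 * r) * r) * r" by (simp add: power2_eq_square)
  also have "\<dots> \<le> \<theta> * r" using size' r(1) by (rule mult_right_mono)
  finally have le_r: "lam * ((A + N / 2 * r) * r\<^sup>2) \<le> \<theta> * r" .
  show ?thesis
  proof (rule nbhdI[where r = "\<theta> * r"])
    have "0 \<le> lam * ((A + N / 2 * r) * r\<^sup>2)" using lam A N r(1) by simp
    then have "(lam * ((A + N / 2 * r) * r\<^sup>2))\<^sup>2 \<le> (\<theta> * r)\<^sup>2" by (rule power_mono[OF le_r])
    then show "Psi (saddle_op f g) (x0, y0) lam (x, y) \<le> (\<theta> * r)\<^sup>2" using Psi by linarith
    have "norm dy \<le> r"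
      by (rule power2_le_imp_le[OF _ r(1)]) (use D zero_le_power2[of "norm dx"] in linarith)
    then have "N / 2 * norm dy \<le> N / 2 * r" using N by (intro mult_left_mono) auto
    \<comment> \<open>The constants fit since \<open>1/2 + 2/3 * 1/4 = 2/3\<close>: the multiplier
      change costs \<open>N / 2 * r\<close>, and \<open>\<theta> \<le> 1/4\<close> keeps the new
      residual term within the remaining \<open>N / 6 * r\<close>.\<close>
    moreover have "2 * N / 3 * (\<theta> * r) \<le> 2 * N / 3 * (1 / 4 * r)"
      using N r(1) \<theta> by (intro mult_left_mono mult_right_mono) auto
    ultimately have "(L0 + inner Lg y) / 2 + 2 * N / 3 * (\<theta> * r) \<le> A + 2 * N / 3 * r"
      using y_le by linarith
    then have "((L0 + inner Lg y) / 2 + 2 * N / 3 * (\<theta> * r)) * (\<theta> * r) \<le> (A + 2 * N / 3 * r) * (\<theta> * r)"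
      by (rule mult_right_mono) (use \<theta> r(1) in simp)
    moreover have "\<bar>y\<bar> = y" using opt(1) by (simp add: vec_eq_iff less_eq_vec_def abs_vec_def)
    ultimately have "size_fun y (\<theta> * r) \<le> (A + 2 * N / 3 * r) * (\<theta> * r)"
      by (simp only: size_fun_def N_def)
    then have "lam * size_fun y (\<theta> * r) \<le> lam * ((A + 2 * N / 3 * r) * (\<theta> * r))"
      using lam by (intro mult_left_mono) auto
    also have "\<dots> = \<theta> * (lam * ((A + 2 * N / 3 * r) * r))" by (simp add: mult_ac)
    also have "\<dots> \<le> \<theta> * \<theta>" using size' \<theta> by (intro mult_left_mono) auto
    finally show "lam * size_fun (snd (x, y)) (\<theta> * r) \<le> \<theta>\<^sup>2" by (simp add: power2_eq_square)
  qed (use lam opt \<theta> r(1) in auto)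
qed

end

section \<open>Complexity of the algorithm\<close>

lemma scaleR_neg_part: "0 \<le> t \<Longrightarrow> t *\<^sub>R neg_part v = neg_part (t *\<^sub>R v)"
  by (simp add: neg_part_def vec_eq_iff max_mult_distrib_left)

text \<open>Converts the logarithmic part of the iteration count into geometric decay.\<close>

lemma log_plus_le_power:
  assumes "0 < X" "0 < q" "q < 1" "log_plus X / ln (1 / q) \<le> real n"
  shows "X * q ^ n \<le> 1"
proof -
  have lnq: "0 < ln (1 / q)" using assms by simp
  then have "log_plus X \<le> real n * ln (1 / q)" using assms(4) by (simp add: pos_divide_le_eq)
  then have "ln X \<le> real n * ln (1 / q)" by (simp add: log_plus_def)
  then have "ln (X * q ^ n) \<le> 0" using assms by (simp add: ln_mult ln_realpow ln_div)
  then show ?thesis using assms by simp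
qed

section \<open>Invariants of a run\<close>

locale algorithm1_run = convex_program f g L0 Lg
  for f :: "real^'n \<Rightarrow> real" and g :: "real^'n \<Rightarrow> real^'m" and L0 :: real and Lg :: "real^'m" +
  fixes \<sigma> \<theta> \<tau> :: real and z zt :: "nat \<Rightarrow> (real^'n) \<times> (real^'m)" and lam :: "nat \<Rightarrow> real"
  assumes alg: "algorithm1 f g L0 Lg \<sigma> \<theta> \<tau> z zt lam"
begin

abbreviation "w \<equiv> w_seq g z zt lam"
abbreviation "v \<equiv> v_seq f g z zt lam"
abbreviation "eps \<equiv> eps_seq g z zt lam"

definition rad :: "nat \<Rightarrow> real" where
  "rad k = rho L0 Lg (snd (zt k)) (\<theta>\<^sup>2 / lam k)"

text \<open>The test for the extragradient branch, which decreases \<open>lam\<close>. In the other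
  branch the displacement is small relative to the radius \<open>rad k\<close>, \<open>lam\<close>
  increases and the model problem is solved.\<close>

definition large_step :: "nat \<Rightarrow> bool" where
  "large_step k \<longleftrightarrow> rad k \<le> \<sigma> * norm (zt k - z (k - 1))"

lemma parameters:
  shows "0 < \<sigma>" "\<sigma> < 1" "0 < \<theta>" "\<theta> \<le> 1/4" "0 < lam 1" "zt 1 \<in> nbhd f g L0 Lg (\<theta>\<^sup>2) (z 0) (lam 1)"
    "z 0 = zt 1" "0 \<le> snd (z 0)" "z 0 \<notin> KKT f g"
  using alg by (auto simp: algorithm1_def algorithm1_init_def)

lemma tau:
  obtains h where "0 < h" "\<theta> * (1 + h) * (1 + h * (1 + 1/\<sigma>))\<^sup>2 = 1" "inverse (1 - \<tau>) = 1 + h"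
    "0 < \<tau>" "\<tau> < 1"
proof -
  obtain h where h: "h > 0" "\<theta> * (1 + h) * (1 + h * (1 + 1/\<sigma>))\<^sup>2 = 1" "\<tau> = h / (1 + h)"
    using alg by (auto simp: algorithm1_def algorithm1_init_def)
  have "1 - \<tau> = inverse (1 + h)" using h(1,3) by (simp add: field_simps)
  then have "inverse (1 - \<tau>) = 1 + h" by simp
  moreover have "0 < \<tau>" "\<tau> < 1" using h(1,3) by simp_all
  ultimately show ?thesis using that h by blast
qed

lemma tau_bounds: "0 < \<tau>" "\<tau> < 1"
  using tau by metis+

lemma step_small:
  assumes "1 \<le> k" "\<not> large_step k"
  shows "lam (Suc k) = inverse (1 - \<tau>) * lam k" "z k = z (k - 1)"
    "solves_min_max (subproblem_obj f g (fst (zt k)) (z k) (lam (Suc k))) (zt (Suc k))"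
proof -
  have step: "algorithm1_step f g L0 Lg \<sigma> \<theta> \<tau> z zt lam k" using alg assms by (simp add: algorithm1_def)
  have "\<not> rho L0 Lg (snd (zt k)) (\<theta>\<^sup>2 / lam k) \<le> \<sigma> * norm (zt k - z (k - 1))"
    using assms(2) by (simp only: large_step_def rad_def not_False_eq_True)
  from step[unfolded algorithm1_step_def Let_def if_not_P[OF this]]
  show "lam (Suc k) = inverse (1 - \<tau>) * lam k" "z k = z (k - 1)"
    "solves_min_max (subproblem_obj f g (fst (zt k)) (z k) (lam (Suc k))) (zt (Suc k))"
    unfolding Suc_eq_plus1 by blast+
qed

lemma step_large:
  assumes "1 \<le> k" "large_step k" "0 < lam k"
  shows "lam (Suc k) = (1 - \<tau>) * lam k" "zt (Suc k) = zt k" "z k = z (k - 1) - (\<tau> * lam k) *\<^sub>R v k"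
proof -
  have step: "algorithm1_step f g L0 Lg \<sigma> \<theta> \<tau> z zt lam k" using alg assms by (simp add: algorithm1_def)
  then show "lam (Suc k) = (1 - \<tau>) * lam k" "zt (Suc k) = zt k"
    using assms(2) by (auto simp: algorithm1_step_def Let_def large_step_def rad_def)
  have zk: "z k = (fst (z (k - 1)) - (\<tau> * lam k) *\<^sub>R
        (gradient f (fst (zt k)) + gradient_matrix g (fst (zt k)) *v snd (zt k)),
      snd (z (k - 1)) + \<tau> *\<^sub>R (lam k *\<^sub>R g (fst (zt k))
        + neg_part (lam k *\<^sub>R g (fst (zt k)) + snd (z (k - 1)))))"
    using step assms(2) by (auto simp: algorithm1_step_def Let_def large_step_def rad_def)
  \<comment> \<open>Positive scaling commutes with \<open>neg_part\<close>; this identifies the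
    multiplier update with the second component of a step along \<open>v k\<close>.\<close>
  have "lam k *\<^sub>R w k = neg_part (lam k *\<^sub>R g (fst (zt k)) + snd (z (k - 1)))"
    using assms(3) by (simp add: w_seq_def scaleR_neg_part scaleR_add_right)
  then have "(\<tau> * lam k) *\<^sub>R w k = \<tau> *\<^sub>R neg_part (lam k *\<^sub>R g (fst (zt k)) + snd (z (k - 1)))"
    by (metis scaleR_scaleR)
  then show "z k = z (k - 1) - (\<tau> * lam k) *\<^sub>R v k"
    unfolding zk by (simp add: prod_eq_iff v_seq_def saddle_op_def scaleR_add_right scaleR_diff_right)
qed

lemma v_eq: "v k = saddle_op f g (zt k) - (0, w k)"
  by (rule v_seq_def)

lemma w_nonneg: "0 \<le> w k"
  by (simp add: w_seq_def neg_part_nonneg)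

lemma invariant:
  assumes "1 \<le> k"
  shows "0 < lam k \<and> zt k \<in> nbhd f g L0 Lg (\<theta>\<^sup>2) (z (k - 1)) (lam k)"
  using assms
proof (induction k rule: nat_induct_at_least)
  case base
  then show ?case using parameters by simp
next
  case (Suc k)
  obtain x y where zt: "zt k = (x, y)" by (cases "zt k")
  obtain x0 y0 where z: "z (k - 1) = (x0, y0)" by (cases "z (k - 1)")
  have IH: "0 < lam k" "(x, y) \<in> nbhd f g L0 Lg (\<theta>\<^sup>2) (x0, y0) (lam k)"
    using Suc.IH unfolding zt z by simp_all
  obtain h where h: "0 < h" "\<theta> * (1 + h) * (1 + h * (1 + 1/\<sigma>))\<^sup>2 = 1" "inverse (1 - \<tau>) = 1 + h"
    by (rule tau)
  show ?case
  proof (cases "large_step k")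
    case True
    note step = step_large[OF Suc.hyps(1) True IH(1)]
    have "v k = saddle_op f g (x, y) - (0, neg_part (g x + inverse (lam k) *\<^sub>R y0))"
      unfolding v_eq w_seq_def zt z by simp
    then show ?thesis
      using nbhd_extragradient[OF IH(1) tau_bounds IH(2)] step IH(1) tau_bounds
      by (simp add: zt z del: One_nat_def)
  next
    case False
    note step = step_small[OF Suc.hyps(1) False]
    have "\<sigma> * norm ((x, y) - (x0, y0)) \<le> rho L0 Lg y (\<theta>\<^sup>2 / lam k)"
      using False unfolding large_step_def rad_def zt z by simp
    then have "(x, y) \<in> nbhd f g L0 Lg \<theta> (x0, y0) ((1 + h) * lam k)"
      using nbhd_enlarge_lam[OF IH(1) h(1) parameters(1,3) h(2) IH(2)] by simp
    moreover have "0 < (1 + h) * lam k" using h(1) IH(1) by simp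
    moreover have lam: "lam (Suc k) = (1 + h) * lam k" using step(1) h(3) by simp
    moreover obtain x1 y1 where zt1: "zt (Suc k) = (x1, y1)" by (cases "zt (Suc k)")
    moreover have "solves_min_max (subproblem_obj f g x (x0, y0) ((1 + h) * lam k)) (x1, y1)"
      using step(3) unfolding step(2) zt z lam zt1 by simp
    ultimately show ?thesis
      using newton_step[of "(1 + h) * lam k" \<theta> x y x0 y0 x1 y1] parameters step(2)
      by (simp add: z del: One_nat_def)
  qed
qed

lemma lam_pos: "1 \<le> k \<Longrightarrow> 0 < lam k"
  using invariant by blast

lemma multiplier_nonneg: "1 \<le> k \<Longrightarrow> 0 \<le> snd (zt k)"
  using invariant by (simp add: nbhd_iff)

lemma eps_nonneg: "1 \<le> k \<Longrightarrow> 0 \<le> eps k"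
  unfolding eps_seq_def by (rule inner_nonneg_vec[OF multiplier_nonneg w_nonneg])

lemma rad_root:
  assumes "1 \<le> k"
  shows "0 < rad k" "size_fun (snd (zt k)) (rad k) = \<theta>\<^sup>2 / lam k"
  using rho_root[of "\<theta>\<^sup>2 / lam k" "snd (zt k)"] lam_pos[OF assms] parameters(3)
  by (simp_all add: rad_def)

lemma residual:
  assumes "1 \<le> k"
  shows "(norm (lam k *\<^sub>R v k + zt k - z (k - 1)))\<^sup>2 + 2 * lam k * eps k \<le> (rad k)\<^sup>2"
proof -
  obtain x y where zt: "zt k = (x, y)" by (cases "zt k")
  obtain x0 y0 where z: "z (k - 1) = (x0, y0)" by (cases "z (k - 1)")
  have "w k = neg_part (g x + inverse (lam k) *\<^sub>R y0)" unfolding w_seq_def zt z by simp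
  then show ?thesis
    using nbhd_residual[of "lam k" "\<theta>\<^sup>2" x y x0 y0] invariant[OF assms] parameters(3)
    by (simp add: v_eq eps_seq_def rad_def zt z del: One_nat_def)
qed

text \<open>The branch test replaces the absolute bound \<open>(rad k)\<^sup>2\<close> on the
  residual by one relative to the step length.\<close>

lemma hpe:
  assumes k: "1 \<le> k" "large_step k" and zs: "zs \<in> KKT f g"
  shows "hpe_step (v k) (zt k) (z (k - 1)) zs (lam k) (eps k) \<sigma>"
proof
  show "- eps k \<le> inner (v k) (zt k - zs)"
    using saddle_KKT_monotone[OF multiplier_nonneg[OF k(1)] w_nonneg[of k] zs, of "fst (zt k)"]
    by (simp add: v_eq eps_seq_def)
  have "(rad k)\<^sup>2 \<le> (\<sigma> * norm (zt k - z (k - 1)))\<^sup>2"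
    using k rad_root(1)[OF k(1)] by (intro power_mono) (auto simp: large_step_def)
  then show "(norm (lam k *\<^sub>R v k + zt k - z (k - 1)))\<^sup>2 + 2 * lam k * eps k
      \<le> \<sigma>\<^sup>2 * (norm (zt k - z (k - 1)))\<^sup>2"
    using residual[OF k(1)] by (simp add: power_mult_distrib)
qed (use lam_pos eps_nonneg k parameters in auto)

section \<open>Fejer monotonicity and the distance to the KKT set\<close>

lemma one_minus_sigma2: "0 < 1 - \<sigma>\<^sup>2"
  using parameters by (simp add: power_less_one_iff abs_square_less_1)

text \<open>Small steps leave the center in place, so only large steps enter the telescoping
  sum.\<close>

lemma fejer_sum:
  assumes "zs \<in> KKT f g"
  shows "(norm (z m - zs))\<^sup>2 + \<tau> * (1 - \<sigma>\<^sup>2) * (\<Sum>k | k \<in> {1..m} \<and> large_step k. (norm (zt k - z (k - 1)))\<^sup>2)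
    \<le> (norm (z 0 - zs))\<^sup>2"
proof (induction m)
  case (Suc m)
  show ?case
  proof (cases "large_step (Suc m)")
    case True
    then have "{k \<in> {1..Suc m}. large_step k} = insert (Suc m) {k \<in> {1..m}. large_step k}"
      by auto
    then have sum: "(\<Sum>k | k \<in> {1..Suc m} \<and> large_step k. (norm (zt k - z (k - 1)))\<^sup>2)
      = (norm (zt (Suc m) - z m))\<^sup>2 + (\<Sum>k | k \<in> {1..m} \<and> large_step k. (norm (zt k - z (k - 1)))\<^sup>2)"
      by simp
    interpret hpe_step "v (Suc m)" "zt (Suc m)" "z (Suc m - 1)" zs "lam (Suc m)" "eps (Suc m)" \<sigma>
      using True assms by (intro hpe) auto
    have "z (Suc m) = z m - (\<tau> * lam (Suc m)) *\<^sub>R v (Suc m)"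
      using step_large(3)[of "Suc m"] True lam_pos[of "Suc m"] by simp
    then show ?thesis
      using fejer[of \<tau>] tau_bounds Suc.IH unfolding sum by (simp add: distrib_left)
  next
    case False
    then have "{k \<in> {1..Suc m}. large_step k} = {k \<in> {1..m}. large_step k}"
      by (auto simp: le_Suc_eq)
    then show ?thesis using step_small(2)[of "Suc m"] False Suc.IH by simp
  qed
qed simp

text \<open>Closedness makes the distance \<open>d0\<close> attained, so that Fejer estimates can be
  taken against one nearest solution, and makes it positive at a starting point that is not
  KKT.\<close>

lemma closed_KKT: "closed (KKT f g)"
proof -
  have cont_grad: "continuous_on UNIV (gradient f)"
    by (intro continuous_at_imp_continuous_on ballI has_derivative_continuous[OF f.has_derivative_gradient])
  have cont_gradg: "continuous_on UNIV (gradient (\<lambda>u. g u $ i))" for i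
    by (intro continuous_at_imp_continuous_on ballI has_derivative_continuous[OF g.has_derivative_gradient])
  have "continuous_on UNIV (\<lambda>x. g x $ i)" for i
    by (intro continuous_at_imp_continuous_on ballI has_derivative_continuous[OF g.has_derivative_f])
  then have "continuous_on UNIV (\<lambda>x. \<chi> i. g x $ i)" by (intro continuous_on_vec_lambda) auto
  then have cont_g: "continuous_on UNIV g" by (simp add: vec_lambda_eta)
  have comp: "continuous_on UNIV (\<lambda>p :: (real^'n) \<times> (real^'m). h (fst p))" if "continuous_on UNIV h"
    for h :: "real^'n \<Rightarrow> 'c::topological_space"
    using continuous_on_compose2[OF that, of "UNIV :: ((real^'n) \<times> (real^'m)) set" fst]
    by (simp add: continuous_on_fst)
  note cont = cont_grad[THEN comp] cont_gradg[THEN comp] cont_g[THEN comp]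
  have "KKT f g = {p. gradient f (fst p) + (\<Sum>i\<in>UNIV. snd p $ i *\<^sub>R gradient (\<lambda>u. g u $ i) (fst p)) = 0}
     \<inter> (\<Inter>i. {p. g (fst p) $ i \<le> 0}) \<inter> (\<Inter>i. {p. 0 \<le> snd p $ i}) \<inter> {p. inner (snd p) (g (fst p)) = 0}"
    using saddle_op_eq by (auto simp: KKT_def saddle_op_def less_eq_vec_def)
  then show ?thesis
    by (simp only:) (intro closed_Int closed_INT ballI closed_Collect_eq closed_Collect_le
        continuous_intros cont)
qed

lemma nearest_KKT:
  obtains zs where "zs \<in> KKT f g" "norm (z 0 - zs) = infdist (z 0) (KKT f g)"
proof -
  have "KKT f g \<noteq> {}" using standing by (simp add: standing_assumptions_def)
  from infdist_attains_inf[OF closed_KKT this, of "z 0"] show ?thesis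
    using that by (metis dist_norm)
qed

lemma infdist_KKT_pos: "0 < infdist (z 0) (KKT f g)"
  using standing closed_KKT parameters(9)
  by (intro infdist_pos_not_in_closed) (simp_all add: standing_assumptions_def)

text \<open>The accumulated powers of \<open>1 - \<tau>\<close> are cross-multiplied to avoid
  negative exponents. The index is \<open>Suc m\<close> because \<open>lam (Suc m)\<close> is the
  outcome of the first \<open>m\<close> steps.\<close>

lemma lam_count:
  "lam (Suc m) * (1 - \<tau>) ^ card {k \<in> {1..m}. \<not> large_step k}
    = lam 1 * (1 - \<tau>) ^ card {k \<in> {1..m}. large_step k}"
proof (induction m)
  case (Suc m)
  have lam: "0 < lam (Suc m)" by (simp add: lam_pos)
  have card: "card {k \<in> {1..Suc m}. P k} = card {k \<in> {1..m}. P k} + (if P (Suc m) then 1 else 0)" for P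
  proof -
    have "{k \<in> {1..Suc m}. P k} = {k \<in> {1..m}. P k} \<union> (if P (Suc m) then {Suc m} else {})"
      by (auto simp: le_Suc_eq)
    then show ?thesis by (simp add: card_insert_if)
  qed
  show ?case
  proof (cases "large_step (Suc m)")
    case True
    then have "lam (Suc (Suc m)) = (1 - \<tau>) * lam (Suc m)"
      using step_large(1)[of "Suc m"] lam by simp
    then show ?thesis using Suc.IH True unfolding card by (simp add: mult.left_commute mult.assoc)
  next
    case False
    then have eq: "lam (Suc (Suc m)) * (1 - \<tau>) = lam (Suc m)"
      using step_small(1)[of "Suc m"] tau_bounds by simp
    show ?thesis using Suc.IH[folded eq] False unfolding card by (simp add: mult.assoc)
  qed
qed simp

text \<open>On a large step \<open>\<theta>\<^sup>2 / lam k\<close>, the size at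
  \<open>rad k\<close>, is at most the size at \<open>\<sigma> * D\<close>. There the coefficient is
  at most \<open>c\<close>: with \<open>q = d0 / sqrt (1 - \<sigma>\<^sup>2)\<close>, the step
  length is at most \<open>q\<close>, and the multiplier moved by at most \<open>q + d0\<close>,
  going through the nearest solution.\<close>

lemma large_step_lower_bound:
  assumes k: "1 \<le> k" "large_step k"
    and d0: "d0 = infdist (z 0) (KKT f g)"
    and c: "c = (L0 + inner Lg \<bar>snd (z 0)\<bar>) / 2
           + (1/2 + (1/2 + 2 * \<sigma> / 3) / sqrt (1 - \<sigma>\<^sup>2)) * d0 * norm Lg"
  shows "\<theta>\<^sup>2 \<le> lam k * norm (zt k - z (k - 1)) * (\<sigma> * c)"
proof -
  obtain zs where zs: "zs \<in> KKT f g" "norm (z 0 - zs) = d0"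
    using nearest_KKT d0 by blast
  interpret hpe_step "v k" "zt k" "z (k - 1)" zs "lam k" "eps k" \<sigma> by (rule hpe[OF k zs(1)])
  define q D where "q = d0 / sqrt (1 - \<sigma>\<^sup>2)" and "D = norm (zt k - z (k - 1))"
  have "0 \<le> \<tau> * (1 - \<sigma>\<^sup>2) * (\<Sum>j | j \<in> {1..k - 1} \<and> large_step j. (norm (zt j - z (j - 1)))\<^sup>2)"
    using tau_bounds one_minus_sigma2 by (intro mult_nonneg_nonneg sum_nonneg) auto
  then have "(norm (z (k - 1) - zs))\<^sup>2 \<le> d0\<^sup>2"
    using fejer_sum[OF zs(1), of "k - 1", unfolded zs(2)] by linarith
  then have "norm (z (k - 1) - zs) \<le> d0"
    by (rule power2_le_imp_le) (simp flip: zs(2))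
  then have q: "norm (z (k - 1) - zs) / sqrt (1 - \<sigma>\<^sup>2) \<le> q"
    using one_minus_sigma2 by (simp add: q_def divide_right_mono)
  have D: "D \<le> q" unfolding D_def using step_length q by (rule order_trans)
  have "norm (zt k - z 0) \<le> norm (zt k - zs) + norm (zs - z 0)"
    using norm_triangle_ineq[of "zt k - zs" "zs - z 0"] by simp
  then have zt: "norm (zt k - z 0) \<le> q + d0"
    using dist_solution q zs(2) by (simp add: norm_minus_commute)
  define y y0 where "y = snd (zt k)" and "y0 = snd (z 0)"
  have abs: "\<bar>y\<bar> = y" "\<bar>y0\<bar> = y0"
    using multiplier_nonneg[OF k(1)] parameters(8)
    by (simp_all add: y_def y0_def vec_eq_iff less_eq_vec_def abs_vec_def)
  have "inner Lg y - inner Lg y0 \<le> norm Lg * norm (y - y0)"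
    using norm_cauchy_schwarz[of Lg "y - y0"] by (simp add: inner_diff_right)
  also have "\<dots> \<le> norm Lg * (q + d0)"
  proof (rule mult_left_mono)
    have "norm (y - y0) \<le> norm (zt k - z 0)" unfolding y_def y0_def snd_diff[symmetric]
      by (metis norm_snd_le prod.collapse)
    then show "norm (y - y0) \<le> q + d0" using zt by linarith
  qed simp
  finally have Ly: "inner Lg y \<le> inner Lg y0 + norm Lg * (q + d0)" by simp
  have "2 * norm Lg / 3 * (\<sigma> * D) \<le> 2 * norm Lg / 3 * (\<sigma> * q)"
    using D \<sigma> by (intro mult_left_mono) auto
  moreover have "c = (L0 + (inner Lg y0 + norm Lg * (q + d0))) / 2 + 2 * norm Lg / 3 * (\<sigma> * q)"
  proof -
    define i where "i = inverse (sqrt (1 - \<sigma>\<^sup>2))"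
    have "a / sqrt (1 - \<sigma>\<^sup>2) = a * i" for a by (simp add: i_def divide_inverse)
    then show ?thesis
      unfolding c abs(2)[unfolded y0_def] q_def y0_def by (simp add: field_simps)
  qed
  ultimately have "(L0 + inner Lg \<bar>y\<bar>) / 2 + 2 * norm Lg / 3 * (\<sigma> * D) \<le> c"
    using Ly unfolding abs add_divide_distrib by linarith
  then have "size_fun y (\<sigma> * D) \<le> c * (\<sigma> * D)"
    unfolding size_fun_def by (rule mult_right_mono) (use \<sigma> in \<open>simp add: D_def\<close>)
  moreover have "size_fun y (rad k) \<le> size_fun y (\<sigma> * D)"
    using k rad_root(1)[OF k(1)] by (intro size_fun_mono) (auto simp: large_step_def D_def)
  ultimately have "\<theta>\<^sup>2 / lam k \<le> c * (\<sigma> * D)"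
    using rad_root(2)[OF k(1)] by (simp add: y_def)
  then show ?thesis
    using lam_pos[OF k(1)] by (simp add: pos_divide_le_eq D_def mult_ac)
qed

text \<open>Dropping the multiplier term only lowers the size function, and
  \<open>lam 1 \<le> lam k\<close>, so \<open>R\<close> bounds \<open>rad k\<close> uniformly. On a
  small step the displacement is at most \<open>R / \<sigma>\<close>, which gives the factor
  \<open>1 + 1/\<sigma>\<close>.\<close>

lemma small_step_bounds:
  assumes k: "1 \<le> k" "\<not> large_step k" and lam: "lam 1 \<le> lam k"
    and R: "0 < R" "\<theta>\<^sup>2 / lam 1 \<le> size_fun 0 R"
  shows "norm (v k) \<le> (1 + 1/\<sigma>) * R / lam k" and "eps k \<le> R\<^sup>2 / (2 * lam k)"
proof -
  note lam_k = lam_pos[OF k(1)]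
  have "size_fun 0 (rad k) \<le> size_fun (snd (zt k)) (rad k)"
    using rad_root(1)[OF k(1)] inner_Lg_abs_nonneg[of "snd (zt k)"] by (simp add: size_fun_eq)
  also have "\<dots> = \<theta>\<^sup>2 / lam k" by (rule rad_root(2)[OF k(1)])
  also have "\<dots> \<le> \<theta>\<^sup>2 / lam 1"
    using lam parameters(5) by (intro divide_left_mono) auto
  also note R(2)
  finally have rad: "rad k \<le> R"
    by (rule size_fun_cancel[rotated]) (use R(1) in simp)
  then have rad2: "(rad k)\<^sup>2 \<le> R\<^sup>2" by (rule power_mono) (use rad_root(1)[OF k(1)] in simp)
  define a where "a = lam k *\<^sub>R v k + zt k - z (k - 1)"
  have res: "(norm a)\<^sup>2 + 2 * lam k * eps k \<le> R\<^sup>2"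
    using residual[OF k(1)] rad2 by (simp add: a_def)
  have "0 \<le> 2 * lam k * eps k" using lam_k eps_nonneg[OF k(1)] by simp
  then have "(norm a)\<^sup>2 \<le> R\<^sup>2" using res by linarith
  then have "norm a \<le> R" by (rule power2_le_imp_le) (use R(1) in simp)
  moreover have "norm (zt k - z (k - 1)) \<le> R / \<sigma>"
    using k(2) rad parameters(1) by (simp add: large_step_def pos_le_divide_eq mult.commute)
  moreover have "norm (lam k *\<^sub>R v k) \<le> norm a + norm (zt k - z (k - 1))"
    using norm_triangle_ineq4[of a "zt k - z (k - 1)"] by (simp add: a_def)
  ultimately have "lam k * norm (v k) \<le> (1 + 1/\<sigma>) * R" using lam_k by (simp add: distrib_right)
  then show "norm (v k) \<le> (1 + 1/\<sigma>) * R / lam k" using lam_k by (simp add: pos_le_divide_eq mult.commute)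
  have "2 * lam k * eps k \<le> R\<^sup>2" using res zero_le_power2[of "norm a"] by linarith
  then have "eps k * (2 * lam k) \<le> R\<^sup>2" by (simp only: mult.commute)
  then show "eps k \<le> R\<^sup>2 / (2 * lam k)" using lam_k by (simp add: pos_le_divide_eq)
qed

lemma many_large_steps:
  assumes d0: "d0 = infdist (z 0) (KKT f g)" and \<eta>: "0 < \<eta>"
    and lower: "\<And>k. 1 \<le> k \<Longrightarrow> large_step k \<Longrightarrow> \<eta> \<le> lam k * norm (zt k - z (k - 1))"
    and \<delta>: "0 < \<delta>" and \<epsilon>: "0 < \<epsilon>"
    and N: "0 < N" "N \<le> real (card {k \<in> {1..m}. large_step k})"
    and N\<delta>: "d0\<^sup>2 / (\<delta> * \<tau> * (1 - \<sigma>) * \<eta>) \<le> N"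
    and N\<epsilon>: "\<sigma> powr (4/3) * d0\<^sup>2 / (\<epsilon> powr (2/3) * \<tau> * (1 - \<sigma>\<^sup>2) * (2 * \<eta>) powr (2/3)) \<le> N"
  shows "\<exists>k. 1 \<le> k \<and> k \<le> m \<and> norm (v k) \<le> \<delta> \<and> eps k \<le> \<epsilon>"
proof -
  obtain zs where zs: "zs \<in> KKT f g" "norm (z 0 - zs) = d0"
    using nearest_KKT d0 by blast
  define A where "A = {k \<in> {1..m}. large_step k}"
  define Q where "Q k = (norm (zt k - z (k - 1)))\<^sup>2" for k
  define \<kappa> where "\<kappa> = \<tau> * (1 - \<sigma>\<^sup>2)"
  have \<kappa>: "0 < \<kappa>" using tau_bounds one_minus_sigma2 by (simp add: \<kappa>_def)
  have sum: "\<kappa> * sum Q A \<le> d0\<^sup>2"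
    using fejer_sum[OF zs(1), of m, unfolded zs(2)] zero_le_power2[of "norm (z m - zs)"]
    unfolding \<kappa>_def Q_def A_def by linarith
  \<comment> \<open>Pigeonhole on the summable squared step lengths.\<close>
  have "\<exists>k\<in>A. Q k * N \<le> d0\<^sup>2 / \<kappa>"
  proof (rule ccontr)
    assume "\<not> ?thesis"
    then have less: "d0\<^sup>2 / \<kappa> / N < Q k" if "k \<in> A" for k
      using that unfolding pos_divide_less_eq[OF N(1)] by (simp add: not_le)
    have "0 < card A" using N by (simp add: A_def)
    then have "finite A" "A \<noteq> {}" by (auto intro: card_ge_0_finite)
    then have "real (card A) * (d0\<^sup>2 / \<kappa> / N) < sum Q A"
      using sum_strict_mono[of A "\<lambda>_. d0\<^sup>2 / \<kappa> / N" Q] less by simp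
    moreover have "N * (d0\<^sup>2 / \<kappa> / N) \<le> real (card A) * (d0\<^sup>2 / \<kappa> / N)"
      using N \<kappa> by (intro mult_right_mono) (auto simp: A_def)
    ultimately have "d0\<^sup>2 / \<kappa> < sum Q A" using N(1) by simp
    then show False using sum \<kappa> by (simp add: pos_divide_less_eq mult.commute)
  qed
  then obtain k where k: "1 \<le> k" "k \<le> m" "large_step k" and Qk: "Q k * N \<le> d0\<^sup>2 / \<kappa>" by (auto simp: A_def)
  then have QN: "\<kappa> * Q k * N \<le> d0\<^sup>2" using \<kappa> by (simp add: pos_le_divide_eq mult_ac)
  interpret hpe_step "v k" "zt k" "z (k - 1)" zs "lam k" "eps k" \<sigma> by (rule hpe[OF k(1,3) zs(1)])
  define D where "D = norm (zt k - z (k - 1))"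
  have QD: "Q k = D\<^sup>2" by (simp add: Q_def D_def)
  have D: "0 \<le> D" by (simp add: D_def)
  have \<eta>D: "\<eta> \<le> lam k * D" unfolding D_def by (rule lower[OF k(1,3)])
  have "norm (v k) \<le> \<delta>"
  proof -
    have pos: "0 < \<tau> * (1 - \<sigma>)" using tau_bounds \<sigma> by simp
    have "d0\<^sup>2 \<le> N * (\<delta> * \<tau> * (1 - \<sigma>) * \<eta>)"
      using N\<delta> tau_bounds \<sigma> \<delta> \<eta> by (subst pos_divide_le_eq[symmetric]) simp_all
    \<comment> \<open>Splitting \<open>1 - \<sigma>\<^sup>2\<close> as
      \<open>(1 - \<sigma>) * (1 + \<sigma>)\<close> produces the factor \<open>1 + \<sigma>\<close>
      that appears in \<open>norm_v\<close>.\<close>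
    then have "(\<tau> * (1 - \<sigma>) * N) * ((1 + \<sigma>) * D\<^sup>2) \<le> (\<tau> * (1 - \<sigma>) * N) * (\<delta> * \<eta>)"
      using QN by (simp add: \<kappa>_def QD power2_eq_square algebra_simps)
    then have "(1 + \<sigma>) * D\<^sup>2 \<le> \<delta> * \<eta>"
      using pos N(1) by (simp only: mult_le_cancel_left_pos mult_pos_pos)
    moreover have "\<eta> * norm (v k) \<le> lam k * D * norm (v k)" by (rule mult_right_mono[OF \<eta>D]) simp
    moreover have "lam k * norm (v k) * D \<le> (1 + \<sigma>) * D * D"
      by (rule mult_right_mono[OF norm_v[folded D_def] D])
    ultimately have "norm (v k) * \<eta> \<le> \<delta> * \<eta>" by (simp add: power2_eq_square mult_ac)
    then show ?thesis using \<eta> by simp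
  qed
  moreover have "eps k \<le> \<epsilon>"
  proof -
    have "\<sigma> powr (4/3) * d0\<^sup>2 \<le> N * (\<epsilon> powr (2/3) * \<tau> * (1 - \<sigma>\<^sup>2) * (2 * \<eta>) powr (2/3))"
      using N\<epsilon> tau_bounds one_minus_sigma2 \<epsilon> \<eta> by (subst pos_divide_le_eq[symmetric]) simp_all
    moreover have "\<sigma> powr (4/3) * (\<kappa> * Q k * N) \<le> \<sigma> powr (4/3) * d0\<^sup>2" by (rule mult_left_mono[OF QN]) simp
    ultimately have "(\<kappa> * N) * (\<sigma> powr (4/3) * D\<^sup>2) \<le> (\<kappa> * N) * (\<epsilon> powr (2/3) * (2 * \<eta>) powr (2/3))"
      by (simp add: \<kappa>_def QD mult_ac)
    then have "\<sigma> powr (4/3) * D\<^sup>2 \<le> \<epsilon> powr (2/3) * (2 * \<eta>) powr (2/3)"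
      using \<kappa> N(1) by (simp only: mult_le_cancel_left_pos mult_pos_pos)
    \<comment> \<open>The count controls \<open>D\<^sup>2\<close>, but the error bound involves
      \<open>D ^ 3\<close>: \<open>2 * lam k * eps k\<close> is at most
      \<open>\<sigma>\<^sup>2 * D\<^sup>2\<close>, and \<open>\<eta> \<le> lam k * D\<close> costs
      one more factor \<open>D\<close>.\<close>
    then have "(\<sigma> powr (4/3) * D\<^sup>2) powr (3/2) \<le> (\<epsilon> powr (2/3) * (2 * \<eta>) powr (2/3)) powr (3/2)"
      by (rule powr_mono2[rotated 2]) auto
    moreover have "(\<sigma> powr (4/3) * D\<^sup>2) powr (3/2) = \<sigma>\<^sup>2 * D ^ 3"
    proof (cases "D = 0")
      case False
      then have "D\<^sup>2 = D powr 2" "D ^ 3 = D powr 3" "\<sigma>\<^sup>2 = \<sigma> powr 2" using D \<sigma> by auto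
      then show ?thesis by (simp add: powr_mult powr_powr)
    qed simp
    moreover have "(\<epsilon> powr (2/3) * (2 * \<eta>) powr (2/3)) powr (3/2) = \<epsilon> * (2 * \<eta>)"
      using \<epsilon> \<eta> by (simp add: powr_mult powr_powr)
    ultimately have "\<sigma>\<^sup>2 * D ^ 3 \<le> \<epsilon> * (2 * \<eta>)" by simp
    moreover have "2 * eps k * \<eta> \<le> 2 * eps k * (lam k * D)"
      using \<eta>D eps by (intro mult_left_mono) auto
    moreover have "2 * lam k * eps k * D \<le> \<sigma>\<^sup>2 * D\<^sup>2 * D"
      by (rule mult_right_mono[OF eps_bound[folded D_def] D])
    ultimately have "eps k * (2 * \<eta>) \<le> \<epsilon> * (2 * \<eta>)"
      by (simp add: power2_eq_square power3_eq_cube mult_ac)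
    then show ?thesis using \<eta> by simp
  qed
  ultimately show ?thesis using k by blast
qed

text \<open>At the last small step \<open>k\<close>, all other small steps lie before it, while at
  most all large ones do. The summand \<open>1\<close> in \<open>count\<close> accounts for
  \<open>k\<close> itself, so increases precede it at least \<open>n\<close> times more often than
  decreases and \<open>lam 1 \<le> lam k * (1 - \<tau>) ^ n\<close>.\<close>

lemma few_large_steps:
  assumes R: "0 < R" "\<theta>\<^sup>2 / lam 1 \<le> size_fun 0 R" and \<delta>: "0 < \<delta>" and \<epsilon>: "0 < \<epsilon>"
    and N\<delta>: "log_plus ((1 + 1/\<sigma>) * R / (\<delta> * lam 1)) / ln (1 / (1 - \<tau>)) \<le> real n"
    and N\<epsilon>: "log_plus (R\<^sup>2 / (2 * \<epsilon> * lam 1)) / ln (1 / (1 - \<tau>)) \<le> real n"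
    and count: "card {k \<in> {1..m}. large_step k} + n + 1 \<le> card {k \<in> {1..m}. \<not> large_step k}"
  shows "\<exists>k. 1 \<le> k \<and> k \<le> m \<and> norm (v k) \<le> \<delta> \<and> eps k \<le> \<epsilon>"
proof -
  define B where "B = {k \<in> {1..m}. \<not> large_step k}"
  define k where "k = Max B"
  have "0 < card B" using count by (simp add: B_def)
  then have fin: "finite B" "B \<noteq> {}" by (auto intro: card_ge_0_finite)
  then have "k \<in> B" unfolding k_def by (rule Max_in)
  then have k: "1 \<le> k" "k \<le> m" "\<not> large_step k" by (auto simp: B_def)
  have kk: "Suc (k - 1) = k" using k(1) by simp
  have "B = insert k {j \<in> {1..k - 1}. \<not> large_step j}"
  proof (intro equalityI subsetI)
    fix j assume j: "j \<in> B"
    then have "j \<le> k" unfolding k_def using fin by simp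
    with j show "j \<in> insert k {j \<in> {1..k - 1}. \<not> large_step j}" by (auto simp: B_def)
  qed (use k in \<open>auto simp: B_def\<close>)
  moreover have "k \<notin> {j \<in> {1..k - 1}. \<not> large_step j}" "finite {j \<in> {1..k - 1}. \<not> large_step j}"
    using k(1) by auto
  ultimately have "card B = Suc (card {j \<in> {1..k - 1}. \<not> large_step j})"
    by (simp only: card_insert_disjoint not_False_eq_True)
  moreover have "card {j \<in> {1..k - 1}. large_step j} \<le> card {k \<in> {1..m}. large_step k}"
    using k by (intro card_mono) auto
  ultimately have cards: "card {j \<in> {1..k - 1}. large_step j} + n \<le> card {j \<in> {1..k - 1}. \<not> large_step j}"
    using count by (simp add: B_def)
  define q a where "q = 1 - \<tau>" and "a = card {j \<in> {1..k - 1}. large_step j}"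
  have q: "0 < q" "q < 1" using tau_bounds by (auto simp: q_def)
  note lam_k = lam_pos[OF k(1)]
  have "lam 1 * q ^ a = lam k * q ^ card {j \<in> {1..k - 1}. \<not> large_step j}"
    using lam_count[of "k - 1"] unfolding kk q_def a_def by simp
  also have "\<dots> \<le> lam k * q ^ (a + n)"
    using cards q lam_k by (intro mult_left_mono power_decreasing) (auto simp: a_def)
  finally have "lam 1 * q ^ a \<le> lam k * q ^ n * q ^ a" by (simp add: power_add mult_ac)
  then have lam1: "lam 1 \<le> lam k * q ^ n" using q by simp
  also have "\<dots> \<le> lam k" using q lam_k by (simp add: mult_left_le power_le_one)
  finally have "lam 1 \<le> lam k" .
  note bounds = small_step_bounds[OF k(1,3) this R]
  have final: "X / lam k \<le> e" if "0 < X" "0 < e" "X / (e * lam 1) * q ^ n \<le> 1" for X e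
  proof -
    have "X * q ^ n \<le> e * lam 1" using that parameters(5) by (simp add: pos_divide_le_eq)
    also have "\<dots> \<le> e * (lam k * q ^ n)" using lam1 that by (intro mult_left_mono) auto
    finally have "X * q ^ n \<le> e * lam k * q ^ n" by (simp add: mult_ac)
    then have "X \<le> e * lam k" using q by simp
    then show ?thesis using lam_k by (simp add: pos_divide_le_eq)
  qed
  have "(1 + 1/\<sigma>) * R / lam k \<le> \<delta>"
  proof (rule final)
    have "0 < 1 / \<sigma>" using parameters(1) by simp
    then show X: "0 < (1 + 1/\<sigma>) * R" using R(1) by (intro mult_pos_pos) linarith+
    then show "(1 + 1/\<sigma>) * R / (\<delta> * lam 1) * q ^ n \<le> 1"
      using N\<delta> q \<delta> parameters(5) by (intro log_plus_le_power) (auto simp: q_def)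
  qed (rule \<delta>)
  moreover have "R\<^sup>2 / 2 / lam k \<le> \<epsilon>"
  proof (rule final)
    show "R\<^sup>2 / 2 / (\<epsilon> * lam 1) * q ^ n \<le> 1"
      using N\<epsilon> q \<epsilon> R(1) parameters(5) by (intro log_plus_le_power) (auto simp: q_def mult.assoc)
  qed (use \<epsilon> R(1) in auto)
  ultimately show ?thesis using bounds k(1,2) by (intro exI[of _ k]) (simp add: field_simps)
qed

end

theorem theorem7p3:
  fixes f :: "real^'n \<Rightarrow> real" and g :: "real^'n \<Rightarrow> real^'m"
    and L0 :: real and Lg :: "real^'m"
    and \<sigma> \<theta> \<tau> :: real
    and z zt :: "nat \<Rightarrow> (real^'n) \<times> (real^'m)" and lam :: "nat \<Rightarrow> real"
    and d0 c \<eta> rhobar \<delta>bar \<epsilon>bar :: real and M :: int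
  assumes "standing_assumptions f g L0 Lg"
    and "algorithm1 f g L0 Lg \<sigma> \<theta> \<tau> z zt lam"
    and "d0 = infdist (z 0) (KKT f g)"
    and "c = (L0 + inner Lg \<bar>snd (z 0)\<bar>) / 2
           + (1/2 + (1/2 + 2 * \<sigma> / 3) / sqrt (1 - \<sigma>\<^sup>2)) * d0 * norm Lg"
    and "\<eta> = \<theta>\<^sup>2 / (\<sigma> * c)"
    and "rhobar = 2 * \<theta>\<^sup>2 /
           (lam 1 * (L0 / 2 + sqrt ((L0 / 2)\<^sup>2 + 8 * norm Lg * \<theta>\<^sup>2 / (3 * lam 1))))"
    and "\<delta>bar > 0" and "\<epsilon>bar > 0"
    and "M = 2 * \<lceil>max (d0\<^sup>2 / (\<delta>bar * \<tau> * (1 - \<sigma>) * \<eta>))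
                     (\<sigma> powr (4/3) * d0\<^sup>2 /
                       (\<epsilon>bar powr (2/3) * \<tau> * (1 - \<sigma>\<^sup>2) * (2 * \<eta>) powr (2/3)))\<rceil>
           + \<lceil>max (log_plus ((1 + 1/\<sigma>) * rhobar / (\<delta>bar * lam 1)))
                  (log_plus (rhobar\<^sup>2 / (2 * \<epsilon>bar * lam 1)))
               / ln (1 / (1 - \<tau>))\<rceil>"
  shows "\<exists>k x y p q \<epsilon>. 1 \<le> k \<and> int k \<le> M \<and>
           ((x, y), (p, q), \<epsilon>) = (zt k, v_seq f g z zt lam k, eps_seq g z zt lam k) \<and>
           (p, q) \<in> eps_subdiff \<epsilon> (\<lambda>(x', y'). Lbar f g x' y - Lbar f g x y') (x, y) \<and>
           norm (p, q) \<le> \<delta>bar \<and> \<epsilon> \<le> \<epsilon>bar \<and>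
           p = gradient f x + gradient_matrix g x *v y \<and>
           g x + q \<le> 0 \<and> 0 \<le> y \<and> inner y (g x + q) = - \<epsilon>"
proof -
  interpret algorithm1_run f g L0 Lg \<sigma> \<theta> \<tau> z zt lam
    using assms(1,2) by unfold_locales
  have d0: "0 < d0" using infdist_KKT_pos assms(3) by simp
  have "0 < (1/2 + (1/2 + 2 * \<sigma> / 3) / sqrt (1 - \<sigma>\<^sup>2)) * d0 * norm Lg"
    using d0 norm_Lg_pos parameters(1) one_minus_sigma2
    by (intro mult_pos_pos add_pos_nonneg divide_nonneg_pos) auto
  then have c: "0 < c"
    using inner_Lg_abs_nonneg[of "snd (z 0)"] f.L_nonneg unfolding assms(4) by (intro add_nonneg_pos) auto
  have \<eta>: "0 < \<eta>" using c parameters by (simp add: assms(5))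
  have lower: "\<eta> \<le> lam k * norm (zt k - z (k - 1))" if "1 \<le> k" "large_step k" for k
    using large_step_lower_bound[OF that assms(3,4)] c parameters(1) by (simp add: assms(5) pos_divide_le_eq)
  \<comment> \<open>\<open>rhobar\<close> is the positive root for the zero multiplier at the
    initial \<open>lam\<close>, so the second claim even holds with equality.\<close>
  have R: "0 < rhobar" "\<theta>\<^sup>2 / lam 1 \<le> size_fun 0 rhobar"
  proof -
    have "rhobar = 2 * (\<theta>\<^sup>2 / lam 1)
        / (L0 / 2 + sqrt ((L0 / 2)\<^sup>2 + 4 * (2 * norm Lg / 3) * (\<theta>\<^sup>2 / lam 1)))"
      unfolding assms(6) by simp
    moreover have "0 < 2 * norm Lg / 3" "0 \<le> L0 / 2" "0 < \<theta>\<^sup>2 / lam 1"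
      using norm_Lg_pos f.L_nonneg parameters by simp_all
    ultimately show "0 < rhobar" "\<theta>\<^sup>2 / lam 1 \<le> size_fun 0 rhobar"
      using quadratic_positive_root[of "2 * norm Lg / 3" "L0 / 2" "\<theta>\<^sup>2 / lam 1"]
      by (simp_all only: size_fun_def abs_zero inner_zero_right add_0_right order_refl)
  qed
  define T where "T = max (d0\<^sup>2 / (\<delta>bar * \<tau> * (1 - \<sigma>) * \<eta>))
    (\<sigma> powr (4/3) * d0\<^sup>2 / (\<epsilon>bar powr (2/3) * \<tau> * (1 - \<sigma>\<^sup>2) * (2 * \<eta>) powr (2/3)))"
  define l where "l = ln (1 / (1 - \<tau>))"
  define U where "U = max (log_plus ((1 + 1/\<sigma>) * rhobar / (\<delta>bar * lam 1)))
    (log_plus (rhobar\<^sup>2 / (2 * \<epsilon>bar * lam 1))) / l"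
  have l: "0 < l" using tau_bounds by (simp add: l_def)
  have "0 < d0\<^sup>2 / (\<delta>bar * \<tau> * (1 - \<sigma>) * \<eta>)"
    using d0 assms(7) tau_bounds parameters(2) \<eta> by simp
  then have "0 < T" unfolding T_def by (rule less_le_trans) simp
  have "0 \<le> U" unfolding U_def using l by (intro divide_nonneg_pos) (auto simp: log_plus_def)
  define N n m where "N = nat \<lceil>T\<rceil>" and "n = nat \<lceil>U\<rceil>" and "m = 2 * N + n"
  have N: "0 < N" "T \<le> real N" using \<open>0 < T\<close> by (auto simp: N_def)
  have n: "U \<le> real n" unfolding n_def by (rule real_nat_ceiling_ge)
  have M: "M = int m"
    using \<open>0 < T\<close> \<open>0 \<le> U\<close> unfolding assms(9) T_def[symmetric] l_def[symmetric] U_def[symmetric]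
    by (simp add: m_def N_def n_def)
  have "\<exists>k. 1 \<le> k \<and> k \<le> m \<and> norm (v k) \<le> \<delta>bar \<and> eps k \<le> \<epsilon>bar"
  proof (cases "N \<le> card {k \<in> {1..m}. large_step k}")
    case True
    show ?thesis
    proof (rule many_large_steps[OF assms(3) \<eta> lower assms(7,8), where N = "real N"])
      show "d0\<^sup>2 / (\<delta>bar * \<tau> * (1 - \<sigma>) * \<eta>) \<le> real N"
        "\<sigma> powr (4/3) * d0\<^sup>2 / (\<epsilon>bar powr (2/3) * \<tau> * (1 - \<sigma>\<^sup>2) * (2 * \<eta>) powr (2/3)) \<le> real N"
        using N(2) by (simp_all add: T_def)
    qed (use N(1) True in simp_all)
  next
    case False
    have "{k \<in> {1..m}. large_step k} \<union> {k \<in> {1..m}. \<not> large_step k} = {1..m}" by auto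
    then have "card {k \<in> {1..m}. large_step k} + card {k \<in> {1..m}. \<not> large_step k} = m"
      by (subst card_Un_disjoint[symmetric]) auto
    \<comment> \<open>At most \<open>N - 1\<close> large steps leave at least
      \<open>N + n + 1\<close> small ones.\<close>
    then have count: "card {k \<in> {1..m}. large_step k} + n + 1 \<le> card {k \<in> {1..m}. \<not> large_step k}"
      using False by (simp add: m_def)
    have "log_plus ((1 + 1/\<sigma>) * rhobar / (\<delta>bar * lam 1)) / l \<le> U" "log_plus (rhobar\<^sup>2 / (2 * \<epsilon>bar * lam 1)) / l \<le> U"
      unfolding U_def using l by (auto intro: divide_right_mono)
    then show ?thesis
      using few_large_steps[OF R assms(7,8) _ _ count] n unfolding l_def[symmetric] by simp
  qed
  then obtain k where k: "1 \<le> k" "k \<le> m" "norm (v k) \<le> \<delta>bar" "eps k \<le> \<epsilon>bar" by blast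
  obtain x y where zt: "zt k = (x, y)" by (cases "zt k")
  have y: "0 \<le> y" using multiplier_nonneg[OF k(1)] by (simp add: zt)
  have v: "v k = saddle_op f g (x, y) - (0, w k)" and eps: "eps k = inner y (w k)"
    by (simp_all add: v_eq eps_seq_def zt)
  have "v k = (gradient f x + gradient_matrix g x *v y, - g x - w k)"
    by (simp add: v saddle_op_def)
  moreover have "v k \<in> eps_subdiff (eps k) (\<lambda>(x', y'). Lbar f g x' y - Lbar f g x y') (x, y)"
    unfolding v eps by (rule saddle_eps_subdiff[OF y w_nonneg])
  \<comment> \<open>With \<open>q = - g x - w k\<close> the perturbed constraint value is
    \<open>- w k\<close>, so feasibility and the complementarity gap \<open>- eps k\<close> are
    immediate.\<close>
  moreover have "g x + (- g x - w k) \<le> 0" using w_nonneg[of k] by (simp add: less_eq_vec_def)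
  moreover have "inner y (g x + (- g x - w k)) = - eps k" by (simp add: eps)
  ultimately show ?thesis
    using k y by (intro exI[of _ k] exI[of _ x] exI[of _ y] exI[of _ "gradient f x + gradient_matrix g x *v y"]
        exI[of _ "- g x - w k"] exI[of _ "eps k"]) (simp add: M zt)
qed

end
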